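(* Let $\xi>0$, $x\in(0,1)$, $\sigma>0$. Let $X\in\mathbb{R}^{n\times p}$, $\beta^*\in\mathbb{R}^p$, $\varepsilon\in\mathbb{R}^n$, $y=X\beta^*+\varepsilon$. Let $T=\{j\in\{1,\dots,p\}:\beta^*_j\ne0\}$, $k=|T|\ge1$, and suppose $X_T^\top X_T$ is invertible. Let $\lambda=(1+\xi)\sigma\sqrt{2\log(ep/k)}$ and let $\hat\beta\in\operatorname{argmin}_{b\in\mathbb{R}^p}\{\|Xb-y\|^2/2+\sqrt n\,\lambda\|b\|_1\}$. Then, in the event $$\Omega=\Bigl\{\sum_{j\in T^c}\Bigl(\frac{|\tilde g_j|}{\sigma}-\Bigl(2\log\frac{ep}{k}\Bigr)^{1/2}\Bigr)_+^2\le kx^2,\quad \|X_T(X_T^\top X_T)^{-1}X_T^\top\varepsilon\|\le\sigma\sqrt k+0.1\lambda\Bigr\},$$ where $\tilde g_j=\varepsilon^\top(I_n-X_T(X_T^\top X_T)^{-1}X_T^\top)Xe_j/\sqrt n$, it holds that $$\max\Bigl\{\mathrm{RE}(T,\xi)\,\|\hat\beta-\beta^*\|,\ \frac{\|X(\hat\beta-\beta^* )\|}{\sqrt n}\Bigr\}\le\frac{\lambda(\sqrt k+0.1)+\sigma\sqrt k(1+x)}{\sqrt n\,\min(1,\mathrm{RE}(T,\xi))}.$$ Moreover, if $\varepsilon\sim N(0,\sigma^2I_n)$ is independent of $X$ and $\max_{j=1,\dots,p}\|Xe_j\|\le\sqrt n$, then $\mathbb{P}(\Omega)\to1$ as $p/k\to+\infty$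 while $(x,\xi)$ are held fixed.
   Context: $\|\cdot\|$ is the Euclidean norm, $\|\cdot\|_1$ the $\ell_1$ norm, $(a)_+=\max(a,0)$, $(e_1,\dots,e_p)$ is the canonical basis of $\mathbb{R}^p$, $T^c=\{1,\dots,p\}\setminus T$, and $X_T\in\mathbb{R}^{n\times k}$ is the submatrix of $X$ made of the columns indexed by $T$. The restricted eigenvalue constant is $$\mathrm{RE}(T,\xi)=\inf\Bigl\{\frac{\|Xh\|}{\sqrt n\,\|h\|}:\ h\in\mathbb{R}^p\setminus\{0\},\ \xi\sum_{j\in T^c}|h_j|\le2(1+\xi)\sqrt k\,\|h\|\Bigr\}.$$ If $\mathrm{RE}(T,\xi)=0$ the right-hand side of the bound is read as $+\infty$. *)

theory Defs
  imports
    "HOL-Probability.Probability"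
    "Jordan_Normal_Form.Gauss_Jordan_Elimination"
    "Jordan_Normal_Form.DL_Submatrix"
begin

unbundle no vec_syntax
unbundle no inner_syntax

text \<open>
  The dimensions \<open>n\<close> and \<open>p\<close> vary along the asymptotics \<open>p / k \<rightarrow> \<infinity>\<close>, so vectors and matrices are
  those with explicit carriers. Coordinates are numbered from \<open>0\<close>: the index set
  \<open>{1, \<dots>, p}\<close> becomes \<open>{..<p}\<close>, and \<open>e\<^sub>j\<close> is \<open>unit_vec p j\<close>.
\<close>

definition norm2 :: "real vec \<Rightarrow> real" where
  "norm2 v = sqrt (\<Sum>i<dim_vec v. (v $ i)\<^sup>2)"

definition norm1 :: "real vec \<Rightarrow> real" where
  "norm1 v = (\<Sum>i<dim_vec v. \<bar>v $ i\<bar>)"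

definition vec_support :: "real vec \<Rightarrow> nat set" where
  "vec_support v = {j. j < dim_vec v \<and> v $ j \<noteq> 0}"

definition cols_submatrix :: "real mat \<Rightarrow> nat set \<Rightarrow> real mat" where
  "cols_submatrix X T = submatrix X UNIV T"

definition gram :: "real mat \<Rightarrow> nat set \<Rightarrow> real mat" where
  "gram X T = transpose_mat (cols_submatrix X T) * cols_submatrix X T"

text \<open>The value at singular matrices is a convention.\<close>

definition inv_mat :: "real mat \<Rightarrow> real mat" where
  "inv_mat A = (case mat_inverse A of
      Some B \<Rightarrow> B
    | None \<Rightarrow> 0\<^sub>m (dim_row A) (dim_row A))"

definition proj_mat :: "real mat \<Rightarrow> nat set \<Rightarrow> real mat" where
  "proj_mat X T =
     cols_submatrix X T * inv_mat (gram X T) * transpose_mat (cols_submatrix X T)"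

text \<open>The infimum is over a nonempty set when \<open>T\<close> is nonempty, and it is bounded below by \<open>0\<close>.\<close>

definition RE :: "real mat \<Rightarrow> nat set \<Rightarrow> real \<Rightarrow> real" where
  "RE X T \<xi> = Inf {norm2 (X *\<^sub>v h) / (sqrt (dim_row X) * norm2 h) | h.
     h \<in> carrier_vec (dim_col X) \<and> h \<noteq> 0\<^sub>v (dim_col X) \<and>
     \<xi> * (\<Sum>j\<in>{..<dim_col X} - T. \<bar>h $ j\<bar>) \<le> 2 * (1 + \<xi>) * sqrt (card T) * norm2 h}"

definition lasso_lambda :: "real \<Rightarrow> real \<Rightarrow> nat \<Rightarrow> nat \<Rightarrow> real" where
  "lasso_lambda \<xi> \<sigma> p k = (1 + \<xi>) * \<sigma> * sqrt (2 * ln (exp 1 * real p / real k))"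

definition lasso_objective :: "real mat \<Rightarrow> real vec \<Rightarrow> real \<Rightarrow> real vec \<Rightarrow> real" where
  "lasso_objective X y lam b =
     (norm2 (X *\<^sub>v b - y))\<^sup>2 / 2 + sqrt (dim_row X) * lam * norm1 b"

definition g_tilde :: "real mat \<Rightarrow> nat set \<Rightarrow> real vec \<Rightarrow> nat \<Rightarrow> real" where
  "g_tilde X T \<epsilon> j =
     (\<epsilon> \<bullet> ((1\<^sub>m (dim_row X) - proj_mat X T) *\<^sub>v (X *\<^sub>v unit_vec (dim_col X) j)))
       / sqrt (dim_row X)"

text \<open>The defining condition of the event \<open>\<Omega>\<close>, as a condition on \<open>X\<close> and \<open>\<epsilon>\<close>.\<close>

definition Omega_cond ::
  "real \<Rightarrow> real \<Rightarrow> real \<Rightarrow> nat set \<Rightarrow> real mat \<Rightarrow> real vec \<Rightarrow> bool" where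
  "Omega_cond \<xi> x \<sigma> T X \<epsilon> \<longleftrightarrow>
     (\<Sum>j\<in>{..<dim_col X} - T.
        (max (\<bar>g_tilde X T \<epsilon> j\<bar> / \<sigma>
              - sqrt (2 * ln (exp 1 * real (dim_col X) / real (card T)))) 0)\<^sup>2)
       \<le> real (card T) * x\<^sup>2 \<and>
     norm2 (proj_mat X T *\<^sub>v \<epsilon>)
       \<le> \<sigma> * sqrt (card T) + 1 / 10 * lasso_lambda \<xi> \<sigma> (dim_col X) (card T)"

text \<open>The Borel sigma-algebras of \<open>\<real>\<^sup>n\<close> and \<open>\<real>\<^sup>n\<^sup>\<times>\<^sup>p\<close>, transported to the carrier sets.\<close>

definition borel_vec :: "nat \<Rightarrow> real vec measure" where
  "borel_vec n = vimage_algebra (carrier_vec n)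
     (\<lambda>v. \<lambda>i\<in>{..<n}. v $ i) (Pi\<^sub>M {..<n} (\<lambda>_. borel))"

definition borel_mat :: "nat \<Rightarrow> nat \<Rightarrow> real mat measure" where
  "borel_mat n p = vimage_algebra (carrier_mat n p)
     (\<lambda>A. \<lambda>ij\<in>{..<n} \<times> {..<p}. A $$ ij) (Pi\<^sub>M ({..<n} \<times> {..<p}) (\<lambda>_. borel))"

text \<open>
  \<open>\<epsilon> \<sim> N(0, \<sigma>\<^sup>2 I\<^sub>n)\<close>: independent coordinates, each of law \<open>N(0, \<sigma>\<^sup>2)\<close>
  (the second argument of \<open>normal_density\<close> is the standard deviation).
\<close>

definition isotropic_gaussian :: "'a measure \<Rightarrow> nat \<Rightarrow> real \<Rightarrow> ('a \<Rightarrow> real vec) \<Rightarrow> bool" where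
  "isotropic_gaussian M n \<sigma> \<epsilon> \<longleftrightarrow>
     \<epsilon> \<in> measurable M (borel_vec n) \<and>
     prob_space.indep_vars M (\<lambda>_. borel) (\<lambda>i \<omega>. \<epsilon> \<omega> $ i) {..<n} \<and>
     (\<forall>i<n. distributed M lborel (\<lambda>\<omega>. \<epsilon> \<omega> $ i) (normal_density 0 \<sigma>))"

text \<open>
  Independence of random variables with values in different types, which \<open>indep_var\<close> does not
  cover: independence of the sigma-algebras they generate.
\<close>

definition indep_rv ::
  "'a measure \<Rightarrow> 'b measure \<Rightarrow> ('a \<Rightarrow> 'b) \<Rightarrow> 'c measure \<Rightarrow> ('a \<Rightarrow> 'c) \<Rightarrow> bool" where
  "indep_rv M S U T V \<longleftrightarrow>
     U \<in> measurable M S \<and> V \<in> measurable M T \<and>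
     prob_space.indep_set M
       (sets (vimage_algebra (space M) U S)) (sets (vimage_algebra (space M) V T))"

end

theory Submission
  imports Defs "Jordan_Normal_Form.Determinant"
begin

text \<open>
  Write \<open>h\<close> for the estimation error, \<open>P\<close> for the orthogonal projection onto the span of the columns
  in \<open>T\<close>, \<open>r = \<epsilon> - X h\<close> for the residual and \<open>L = \<surd>(2 log (e p / k))\<close>. Optimality gives
  \<open>\<langle>r, X v\<rangle> \<le> \<surd>n \<lambda> (\<parallel>b + v\<parallel>\<^sub>1 - \<parallel>b\<parallel>\<^sub>1)\<close> for every direction \<open>v\<close>. For \<open>v = - h\<close> this is the usual basic
  inequality, where \<open>\<langle>\<epsilon>, X h\<rangle> = \<langle>P \<epsilon>, X h\<rangle> + \<surd>n (\<Sum>j\<notin>T. g\<^sub>j h\<^sub>j)\<close> is controlled on \<open>\<Omega>\<close>. If \<open>h\<close> is in the cone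
  of the restricted eigenvalue, this suffices. If not, the \<open>\<ell>\<^sub>1\<close> penalty dominates, so
  \<open>\<surd>n \<lambda> \<surd>k \<parallel>h\<parallel>\<close> is at most a multiple of \<open>\<langle>P r, P \<epsilon> - P r\<rangle> \<le> \<parallel>P r\<parallel> \<parallel>P \<epsilon>\<parallel>\<close>, and optimality for the \<open>v\<close>
  supported on \<open>T\<close> with \<open>X v = P r\<close> gives \<open>\<parallel>P r\<parallel> \<le> \<lambda> \<surd>k / RE\<close>.

  For the probability, independence lets one fix \<open>X\<close>. A Chernoff bound shows that the sum defining
  \<open>\<Omega>\<close> has expectation at most \<open>4 k / L\<^sup>2\<close>, and \<open>\<parallel>P \<epsilon>\<parallel>\<^sup>2\<close> has mean \<open>\<sigma>\<^sup>2 k\<close> and variance \<open>2 \<sigma>\<^sup>4 k\<close>. By the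
  inequalities of Markov and Chebyshev the complement of \<open>\<Omega>\<close> has probability \<open>O(1 / L\<^sup>2)\<close>.
\<close>

section \<open>Projections onto column spans\<close>

lemma norm2_eq_L2_set: "norm2 v = L2_set (\<lambda>i. v $ i) {..<dim_vec v}"
  by (simp add: norm2_def L2_set_def)

lemma norm2_nonneg: "0 \<le> norm2 v"
  by (simp add: norm2_eq_L2_set)

lemma norm2_power2: "(norm2 v)\<^sup>2 = v \<bullet> v"
  by (simp add: norm2_def scalar_prod_def sum_nonneg power2_eq_square lessThan_atLeast0)

lemma norm2_eq_0_iff: "norm2 v = 0 \<longleftrightarrow> v = 0\<^sub>v (dim_vec v)"
proof
  assume "norm2 v = 0"
  then show "v = 0\<^sub>v (dim_vec v)" by (intro eq_vecI) (auto simp: norm2_eq_L2_set L2_set_eq_0_iff)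
next
  assume "v = 0\<^sub>v (dim_vec v)"
  then have "v $ i = 0" if "i < dim_vec v" for i
    using that by (metis index_zero_vec(1))
  then show "norm2 v = 0" by (simp add: norm2_eq_L2_set L2_set_eq_0_iff)
qed

lemma scalar_prod_le_norm2:
  assumes "v \<in> carrier_vec n" "w \<in> carrier_vec n"
  shows "v \<bullet> w \<le> norm2 v * norm2 w"
proof -
  have "v \<bullet> w \<le> (\<Sum>i<n. \<bar>v $ i\<bar> * \<bar>w $ i\<bar>)"
    using assms unfolding scalar_prod_def lessThan_atLeast0
    by (auto intro!: sum_mono simp: abs_mult[symmetric])
  also have "\<dots> \<le> norm2 v * norm2 w"
    using assms L2_set_mult_ineq[of "\<lambda>i. v $ i" "\<lambda>i. w $ i" "{..<n}"]
    by (simp add: norm2_eq_L2_set)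
  finally show ?thesis .
qed

lemma sum_abs_le_sqrt_card_L2_set: "(\<Sum>i\<in>A. \<bar>f i\<bar>) \<le> sqrt (card A) * L2_set f A"
  using L2_set_mult_ineq[of "\<lambda>_. 1" f A] by (simp add: L2_set_def)

lemma mult_mat_unit_vec:
  fixes A :: "real mat"
  assumes "A \<in> carrier_mat n p" "j < p"
  shows "A *\<^sub>v unit_vec p j = col A j"
  using assms by (intro eq_vecI) auto

text \<open>An inverse in the sense of \<open>invertible_mat\<close> makes the matrix a unit of the
  matrix ring, which rules out the \<open>None\<close> branch in the definition of
  \<open>inv_mat\<close>.\<close>

lemma inv_mat_inverse:
  assumes A: "A \<in> carrier_mat k k" and "invertible_mat A"
  shows "inv_mat A \<in> carrier_mat k k" "A * inv_mat A = 1\<^sub>m k" "inv_mat A * A = 1\<^sub>m k"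
proof -
  obtain B where B: "A * B = 1\<^sub>m k" "B * A = 1\<^sub>m (dim_row B)"
    using assms by (auto simp: invertible_mat_def inverts_mat_def)
  \<comment> \<open>\<open>invertible_mat\<close> does not state the shape of \<open>B\<close>;
    comparing dimensions on both sides of the two products forces it to be k by k.\<close>
  from arg_cong[OF B(1), of dim_col] arg_cong[OF B(2), of dim_col] A
  have "B \<in> carrier_mat k k" by auto
  then have "A \<in> Units (ring_mat TYPE(real) k ())"
    using A B by (auto simp: Units_def ring_mat_def)
  then obtain C where "mat_inverse A = Some C"
    using mat_inverse(1)[OF A, where b="()"] by (cases "mat_inverse A") auto
  then show "inv_mat A \<in> carrier_mat k k" "A * inv_mat A = 1\<^sub>m k" "inv_mat A * A = 1\<^sub>m k"
    using mat_inverse(2)[OF A] by (auto simp: inv_mat_def)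
qed

text \<open>Cramer's rule: it makes the entries of the inverse rational functions of the entries of
  \<open>A\<close>, the form from which measurability is obtained later.\<close>

lemma inv_mat_eq_adj_mat:
  assumes A: "A \<in> carrier_mat k k" and "det A \<noteq> 0"
  shows "inv_mat A = (1 / det A) \<cdot>\<^sub>m adj_mat A"
proof -
  define B where "B = (1 / det A) \<cdot>\<^sub>m adj_mat A"
  have B: "B \<in> carrier_mat k k" "A * B = 1\<^sub>m k" "B * A = 1\<^sub>m k"
    using adj_mat[OF A] assms A by (auto simp: B_def mult_smult_distrib mult_smult_assoc_mat)
  then have "invertible_mat A"
    using A by (auto simp: invertible_mat_def inverts_mat_def)
  note inv = inv_mat_inverse[OF A this]
  have "inv_mat A = inv_mat A * (A * B)" using inv(1) B(2) by simp
  also have "\<dots> = (inv_mat A * A) * B" using inv(1) B(1) A by (simp add: assoc_mult_mat[of _ k k _ k _ k])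
  also have "\<dots> = B" using inv B by simp
  finally show ?thesis by (simp add: B_def)
qed

text \<open>An inverse returned by \<open>mat_inverse\<close> would give
  \<open>det A * det B = 1\<close>, so the default value applies. With the adjugate formula this
  describes \<open>inv_mat\<close> on all square matrices.\<close>

lemma inv_mat_singular:
  assumes A: "A \<in> carrier_mat k k" and "det A = 0"
  shows "inv_mat A = 0\<^sub>m k k"
proof (cases "mat_inverse A")
  case None
  then show ?thesis using A by (simp add: inv_mat_def)
next
  case (Some B)
  then have B: "A * B = 1\<^sub>m k" "B \<in> carrier_mat k k" using mat_inverse(2)[OF A] by auto
  then have "det A * det B = 1" using det_mult[OF A B(2)] by simp
  then show ?thesis using assms by simp
qed

section \<open>Column submatrices and their indexing by \<open>pick\<close>\<close>

context
  fixes X :: "real mat" and n p :: nat and T :: "nat set"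
  assumes X: "X \<in> carrier_mat n p" and T: "T \<subseteq> {..<p}"
begin

lemma card_column_subset: "card {j. j < p \<and> j \<in> T} = card T"
  using T by (intro arg_cong[of _ _ card]) auto

lemma cols_submatrix_carrier: "cols_submatrix X T \<in> carrier_mat n (card T)"
  using X card_column_subset by (intro carrier_matI) (auto simp: cols_submatrix_def dim_submatrix)

lemma pick_less: "m < card T \<Longrightarrow> pick T m < p"
  using T pick_in_set_le[of m T] by auto

lemma cols_submatrix_index:
  "i < n \<Longrightarrow> m < card T \<Longrightarrow> cols_submatrix X T $$ (i, m) = X $$ (i, pick T m)"
  unfolding cols_submatrix_def using X card_column_subset
  by (subst submatrix_index) (auto simp: pick_UNIV)

end

text \<open>A deterministic design with invertible Gram matrix. It serves the deterministic bound
  and also, once a random design is frozen at an outcome, the probability estimate.\<close>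

locale regular_design =
  fixes X :: "real mat" and n p :: nat and T :: "nat set"
  assumes X: "X \<in> carrier_mat n p" and T: "T \<subseteq> {..<p}"
    and inv: "invertible_mat (gram X T)"
begin

abbreviation "XT \<equiv> cols_submatrix X T"
abbreviation "k \<equiv> card T"
abbreviation "B \<equiv> inv_mat (gram X T)"
abbreviation "P \<equiv> proj_mat X T"

lemmas XT_carrier = cols_submatrix_carrier[OF X T]
lemmas XT_index = cols_submatrix_index[OF X T]
lemmas pick_T = pick_in_set_le[of _ T] pick_less[OF X T]

lemma col_XT: "m < k \<Longrightarrow> col XT m = col X (pick T m)"
  using X XT_carrier pick_T(2)[of m] by (intro eq_vecI) (auto simp: XT_index)

lemma G_carrier: "gram X T \<in> carrier_mat k k"
  using XT_carrier by (auto simp: gram_def)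

lemmas B = inv_mat_inverse[OF G_carrier inv]

lemma P_carrier: "P \<in> carrier_mat n n"
  using XT_carrier by (auto simp: proj_mat_def)

lemma XT_transpose_carrier: "transpose_mat XT \<in> carrier_mat k n"
  using XT_carrier by simp

lemma XT_B_carrier: "XT * B \<in> carrier_mat n k"
  using XT_carrier B(1) by (rule mult_carrier_mat)

lemma P_mult_XT: "P * XT = XT"
proof -
  have "P * XT = (XT * B) * gram X T"
    using assoc_mult_mat[OF XT_B_carrier XT_transpose_carrier XT_carrier]
    by (simp only: proj_mat_def gram_def)
  also have "\<dots> = XT * (B * gram X T)"
    by (rule assoc_mult_mat[OF XT_carrier B(1) G_carrier])
  finally show ?thesis using B(3) XT_carrier by simp
qed

text \<open>Transposing \<open>B * gram X T = 1\<close> shows that the transpose of \<open>B\<close>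
  is a right inverse of the symmetric Gram matrix, hence equal to \<open>B\<close>.\<close>

lemma B_sym: "transpose_mat B = B"
proof -
  have G: "transpose_mat (gram X T) = gram X T"
    using XT_carrier by (auto simp: gram_def transpose_mult[of _ k n _ k])
  have BT: "gram X T * transpose_mat B = 1\<^sub>m k"
    using transpose_mult[OF B(1) G_carrier] B G by simp
  have "transpose_mat B = (B * gram X T) * transpose_mat B"
    using B by simp
  also have "\<dots> = B * (gram X T * transpose_mat B)"
    using B G_carrier by (intro assoc_mult_mat) auto
  finally show ?thesis using BT B by simp
qed

lemma P_sym: "transpose_mat P = P"
proof -
  have "transpose_mat P = transpose_mat (transpose_mat XT) * transpose_mat (XT * B)"
    unfolding proj_mat_def by (rule transpose_mult[OF XT_B_carrier XT_transpose_carrier])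
  also have "transpose_mat (XT * B) = B * transpose_mat XT"
    using transpose_mult[OF XT_carrier B(1)] B_sym by simp
  also have "transpose_mat (transpose_mat XT) * (B * transpose_mat XT) = P"
    unfolding proj_mat_def transpose_transpose
    by (rule assoc_mult_mat[OF XT_carrier B(1) XT_transpose_carrier, symmetric])
  finally show ?thesis .
qed

lemma P_idem: "P * P = P"
proof -
  have "P * ((XT * B) * transpose_mat XT) = (P * (XT * B)) * transpose_mat XT"
    by (rule assoc_mult_mat[OF P_carrier XT_B_carrier XT_transpose_carrier, symmetric])
  also have "P * (XT * B) = XT * B"
    using assoc_mult_mat[OF P_carrier XT_carrier B(1)] P_mult_XT by simp
  finally show ?thesis by (simp only: proj_mat_def)
qed

text \<open>Cyclicity turns the trace of \<open>P\<close> into that of the k by k identity. Up to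
  the factor \<open>\<sigma>\<^sup>2\<close>, it is the mean of the squared norm of the projected
  noise.\<close>

lemma P_trace: "(\<Sum>i<n. P $$ (i, i)) = k"
proof -
  define C where "C = XT * B"
  have C: "C \<in> carrier_mat n k" using XT_B_carrier by (simp add: C_def)
  have "(\<Sum>i<n. P $$ (i, i)) = (\<Sum>i<n. \<Sum>m<k. C $$ (i, m) * XT $$ (i, m))"
    using XT_carrier C unfolding proj_mat_def C_def[symmetric]
    by (simp add: scalar_prod_def lessThan_atLeast0)
  also have "\<dots> = (\<Sum>m<k. \<Sum>i<n. XT $$ (i, m) * C $$ (i, m))"
    by (subst sum.swap) (simp add: mult.commute)
  also have "\<dots> = (\<Sum>m<k. (transpose_mat XT * C) $$ (m, m))"
    using XT_carrier C by (simp add: scalar_prod_def lessThan_atLeast0)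
  also have "transpose_mat XT * C = gram X T * B"
    using assoc_mult_mat[OF XT_transpose_carrier XT_carrier B(1)]
    by (simp only: C_def gram_def)
  finally show ?thesis using B by simp
qed

text \<open>Since \<open>P\<close> equals \<open>P\<close> times its transpose, each row has its
  diagonal entry as sum of squares. This sum gives the variance of the squared norm of the projected
  noise.\<close>

lemma P_sq_sum: "(\<Sum>i<n. \<Sum>j<n. (P $$ (i, j))\<^sup>2) = k"
proof -
  have "(\<Sum>j<n. (P $$ (i, j))\<^sup>2) = P $$ (i, i)" if "i < n" for i
  proof -
    have "P $$ (i, i) = (P * transpose_mat P) $$ (i, i)" by (simp add: P_sym P_idem)
    also have "\<dots> = (\<Sum>j<n. (P $$ (i, j))\<^sup>2)"
      using P_carrier that by (simp add: scalar_prod_def lessThan_atLeast0 power2_eq_square)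
    finally show ?thesis by simp
  qed
  then show ?thesis using P_trace by simp
qed

lemma P_col:
  assumes "j \<in> T" shows "P *\<^sub>v col X j = col X j"
proof -
  \<comment> \<open>The position of \<open>j\<close> in \<open>T\<close>, counted from 0.\<close>
  define m where "m = card {a \<in> T. a < j}"
  have "finite T" using T finite_subset by blast
  then have "m < k" unfolding m_def using assms by (intro psubset_card_mono) auto
  moreover have "pick T m = j" unfolding m_def using assms by (rule pick_card_in_set)
  ultimately have j: "col X j = col XT m" using col_XT by simp
  have "P *\<^sub>v col XT m = col (P * XT) m"
    using P_carrier XT_carrier \<open>m < k\<close> by (intro eq_vecI) auto
  then show ?thesis by (simp add: j P_mult_XT)
qed

text \<open>The coefficients of the projection in the columns of \<open>XT\<close>, scattered back
  to the coordinates in \<open>T\<close>, give a direction supported on \<open>T\<close> that can be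
  fed to the optimality condition.\<close>

lemma P_range:
  assumes w: "w \<in> carrier_vec n"
  obtains v where "v \<in> carrier_vec p" "\<And>j. j < p \<Longrightarrow> j \<notin> T \<Longrightarrow> v $ j = 0" "P *\<^sub>v w = X *\<^sub>v v"
proof -
  define c where "c = B *\<^sub>v (transpose_mat XT *\<^sub>v w)"
  have c: "c \<in> carrier_vec k" using B XT_carrier w by (auto simp: c_def)
  have Pw: "P *\<^sub>v w = XT *\<^sub>v c"
    using assoc_mult_mat_vec[OF XT_B_carrier XT_transpose_carrier w]
      assoc_mult_mat_vec[OF XT_carrier B(1), of "transpose_mat XT *\<^sub>v w"] XT_transpose_carrier w
    by (simp add: proj_mat_def c_def)
  \<comment> \<open>Writing the scatter as a sum over \<open>m\<close> avoids inverting
    \<open>pick\<close>: the product with \<open>X\<close> is computed by swapping two sums.\<close>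
  define v where "v = vec p (\<lambda>j. \<Sum>m<k. if j = pick T m then c $ m else 0)"
  have v: "v \<in> carrier_vec p" by (simp add: v_def)
  have "X *\<^sub>v v = XT *\<^sub>v c"
  proof (intro eq_vecI)
    fix i assume "i < dim_vec (XT *\<^sub>v c)"
    then have i: "i < n" using XT_carrier by auto
    have "(X *\<^sub>v v) $ i = (\<Sum>j<p. \<Sum>m<k. if j = pick T m then X $$ (i, j) * c $ m else 0)"
      using i X by (simp add: v_def scalar_prod_def lessThan_atLeast0 sum_distrib_left if_distrib cong: if_cong)
    also have "\<dots> = (\<Sum>m<k. X $$ (i, pick T m) * c $ m)"
      by (subst sum.swap) (auto simp: pick_T intro!: sum.cong)
    also have "\<dots> = (XT *\<^sub>v c) $ i"
      using i XT_carrier c by (simp add: XT_index scalar_prod_def lessThan_atLeast0)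
    finally show "(X *\<^sub>v v) $ i = (XT *\<^sub>v c) $ i" .
  qed (use X XT_carrier in auto)
  moreover have "v $ j = 0" if "j < p" "j \<notin> T" for j
    using that pick_T by (auto simp: v_def intro!: sum.neutral)
  ultimately show ?thesis using that v Pw by simp
qed

lemma P_mult_carrier: "v \<in> carrier_vec n \<Longrightarrow> P *\<^sub>v v \<in> carrier_vec n"
  by (rule mult_mat_vec_carrier[OF P_carrier])

lemma P_swap:
  assumes "v \<in> carrier_vec n" "w \<in> carrier_vec n"
  shows "v \<bullet> (P *\<^sub>v w) = (P *\<^sub>v v) \<bullet> w"
  using transpose_vec_mult_scalar[OF P_carrier assms(2,1)] unfolding P_sym by (rule sym)

lemma P_twice:
  assumes "v \<in> carrier_vec n"
  shows "P *\<^sub>v (P *\<^sub>v v) = P *\<^sub>v v"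
proof -
  have "(P * P) *\<^sub>v v = P *\<^sub>v (P *\<^sub>v v)"
    by (rule assoc_mult_mat_vec[OF P_carrier P_carrier assms])
  then show ?thesis unfolding P_idem by (rule sym)
qed

lemma norm2_P_power2:
  assumes "v \<in> carrier_vec n"
  shows "(norm2 (P *\<^sub>v v))\<^sup>2 = v \<bullet> (P *\<^sub>v v)"
proof -
  have "v \<bullet> (P *\<^sub>v (P *\<^sub>v v)) = (P *\<^sub>v v) \<bullet> (P *\<^sub>v v)"
    by (rule P_swap[OF assms P_mult_carrier[OF assms]])
  then show ?thesis unfolding P_twice[OF assms] norm2_power2 by (rule sym)
qed

lemma compl_P_mult:
  assumes "v \<in> carrier_vec n" shows "(1\<^sub>m n - P) *\<^sub>v v = v - P *\<^sub>v v"
  using assms P_carrier by (simp add: minus_mult_distrib_mat_vec[of _ n n])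

text \<open>Pythagoras. It yields that both \<open>P\<close> and its complement are
  contractions.\<close>

lemma norm2_compl_P:
  assumes v: "v \<in> carrier_vec n"
  shows "(norm2 (v - P *\<^sub>v v))\<^sup>2 = (norm2 v)\<^sup>2 - (norm2 (P *\<^sub>v v))\<^sup>2"
proof -
  note Pv = P_mult_carrier[OF v]
  have "(v - P *\<^sub>v v) \<bullet> (v - P *\<^sub>v v) = v \<bullet> v - v \<bullet> (P *\<^sub>v v) - ((P *\<^sub>v v) \<bullet> v - (P *\<^sub>v v) \<bullet> (P *\<^sub>v v))"
    using v Pv by (simp add: minus_scalar_prod_distrib[of _ n] scalar_prod_minus_distrib[of _ n])
  then show ?thesis
    using P_swap[OF v v] norm2_P_power2[OF v] norm2_power2[of "P *\<^sub>v v"] norm2_power2 by simp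
qed

end

section \<open>The Lasso bound\<close>

lemma norm1_convex:
  assumes "b \<in> carrier_vec p" "v \<in> carrier_vec p" "0 \<le> t" "t \<le> 1"
  shows "norm1 (b + t \<cdot>\<^sub>v v) \<le> (1 - t) * norm1 b + t * norm1 (b + v)"
proof -
  have "\<bar>b $ i + t * v $ i\<bar> \<le> (1 - t) * \<bar>b $ i\<bar> + t * \<bar>b $ i + v $ i\<bar>" for i
  proof -
    have "\<bar>b $ i + t * v $ i\<bar> = \<bar>(1 - t) * b $ i + t * (b $ i + v $ i)\<bar>"
      by (simp add: algebra_simps)
    also have "\<dots> \<le> \<bar>(1 - t) * b $ i\<bar> + \<bar>t * (b $ i + v $ i)\<bar>" by (rule abs_triangle_ineq)
    finally show ?thesis using assms(3,4) by (simp add: abs_mult)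
  qed
  then show ?thesis
    using assms(1,2) by (simp add: norm1_def sum_distrib_left flip: sum.distrib) (intro sum_mono, simp)
qed

text \<open>Compare the objective at \<open>b\<close> and at \<open>b + t v\<close> for small t: by
  convexity the penalty grows at most linearly in t, and the quadratic term is of order t squared.
  This replaces subgradient calculus.\<close>

lemma lasso_optimality:
  assumes X: "X \<in> carrier_mat n p" and y: "y \<in> carrier_vec n" and lam: "0 \<le> lam"
    and argmin: "is_arg_min (lasso_objective X y lam) (\<lambda>b. b \<in> carrier_vec p) b"
    and v: "v \<in> carrier_vec p"
  shows "(y - X *\<^sub>v b) \<bullet> (X *\<^sub>v v) \<le> sqrt n * lam * (norm1 (b + v) - norm1 b)"
proof (rule ccontr)
  have b: "b \<in> carrier_vec p" using argmin by (simp add: is_arg_min_def)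
  define r where "r = y - X *\<^sub>v b"
  define w where "w = X *\<^sub>v v"
  define q where "q = w \<bullet> w"
  define D where "D = r \<bullet> w - sqrt n * lam * (norm1 (b + v) - norm1 b)"
  assume "\<not> ?thesis"
  then have D: "0 < D" by (simp add: D_def r_def w_def)
  have r: "r \<in> carrier_vec n" and w: "w \<in> carrier_vec n"
    using X y b v by (auto simp: r_def w_def)
  have q: "0 \<le> q" by (simp add: q_def norm2_power2[symmetric])
  have less: "D \<le> t * q / 2" if t: "0 < t" "t \<le> 1" for t
  proof -
    have tv: "b + t \<cdot>\<^sub>v v \<in> carrier_vec p" using b v by simp
    have eq0: "(norm2 (X *\<^sub>v b - y))\<^sup>2 = r \<bullet> r"
    proof -
      have "X *\<^sub>v b - y = - r" using X b y by (intro eq_vecI) (auto simp: r_def)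
      then show ?thesis using r by (simp add: norm2_power2)
    qed
    have eq1: "(norm2 (X *\<^sub>v (b + t \<cdot>\<^sub>v v) - y))\<^sup>2 = t\<^sup>2 * q - 2 * t * (r \<bullet> w) + r \<bullet> r"
    proof -
      have "X *\<^sub>v (b + t \<cdot>\<^sub>v v) = X *\<^sub>v b + t \<cdot>\<^sub>v w"
        using X b v by (simp add: mult_add_distrib_mat_vec[of _ n p] mult_mat_vec[of _ n p] w_def)
      then have *: "X *\<^sub>v (b + t \<cdot>\<^sub>v v) - y = t \<cdot>\<^sub>v w - r"
        using X b y w by (intro eq_vecI) (auto simp: r_def)
      show ?thesis unfolding * norm2_power2 using r w
        by (simp add: minus_scalar_prod_distrib[of _ n] scalar_prod_minus_distrib[of _ n]
            comm_scalar_prod[of w n r] power2_eq_square q_def algebra_simps)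
    qed
    have "lasso_objective X y lam b \<le> lasso_objective X y lam (b + t \<cdot>\<^sub>v v)"
      using argmin tv unfolding is_arg_min_def by (metis linorder_not_less)
    then have "r \<bullet> r / 2 + sqrt n * lam * norm1 b
        \<le> (t\<^sup>2 * q - 2 * t * (r \<bullet> w) + r \<bullet> r) / 2 + sqrt n * lam * norm1 (b + t \<cdot>\<^sub>v v)"
      using X unfolding lasso_objective_def eq0 eq1 by simp
    also have "sqrt n * lam * norm1 (b + t \<cdot>\<^sub>v v)
        \<le> sqrt n * lam * ((1 - t) * norm1 b + t * norm1 (b + v))"
      using norm1_convex[OF b v, of t] t lam by (intro mult_left_mono) auto
    finally have "t * D \<le> t * (t * q / 2)"
      by (simp add: D_def field_simps power2_eq_square)
    then show ?thesis using t by simp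
  qed
  \<comment> \<open>This t satisfies \<open>t * q \<le> D\<close>, so \<open>less\<close> would give
    \<open>D \<le> D / 2\<close>.\<close>
  define t where "t = min 1 (D / (q + 1))"
  have "t * q \<le> D / (q + 1) * q" using q D by (intro mult_right_mono) (auto simp: t_def)
  also have "\<dots> \<le> D" using q D by (simp add: field_simps)
  finally show False using less[of t] q D by (simp add: t_def)
qed

section \<open>The restricted eigenvalue constant\<close>

lemma RE_set_bdd:
  "bdd_below {norm2 (X *\<^sub>v h) / (sqrt (dim_row X) * norm2 h) | h.
     h \<in> carrier_vec (dim_col X) \<and> h \<noteq> 0\<^sub>v (dim_col X) \<and>
     \<xi> * (\<Sum>j\<in>{..<dim_col X} - T. \<bar>h $ j\<bar>) \<le> 2 * (1 + \<xi>) * sqrt (card T) * norm2 h}"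
  by (rule bdd_belowI[of _ 0]) (auto simp: norm2_nonneg)

text \<open>The zero vector is excluded from the infimum, so it is treated apart; there the left
  side vanishes.\<close>

lemma RE_le:
  assumes X: "X \<in> carrier_mat n p" and "0 < n" and h: "h \<in> carrier_vec p"
    and cone: "\<xi> * (\<Sum>j\<in>{..<p} - T. \<bar>h $ j\<bar>) \<le> 2 * (1 + \<xi>) * sqrt (card T) * norm2 h"
  shows "sqrt n * RE X T \<xi> * norm2 h \<le> norm2 (X *\<^sub>v h)"
proof (cases "h = 0\<^sub>v p")
  case True
  then have "norm2 h = 0" using norm2_eq_0_iff[of h] by simp
  then show ?thesis by (simp add: norm2_nonneg)
next
  case False
  then have "0 < norm2 h" using h norm2_eq_0_iff[of h] norm2_nonneg[of h] by auto
  moreover have "RE X T \<xi> \<le> norm2 (X *\<^sub>v h) / (sqrt (dim_row X) * norm2 h)"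
    unfolding RE_def using X h cone False by (intro cInf_lower[OF _ RE_set_bdd]) auto
  ultimately show ?thesis using X \<open>0 < n\<close> by (simp add: field_simps)
qed

text \<open>A lower bound on the ratios passes to \<open>Inf\<close> only over a nonempty set. A
  basis vector indexed by \<open>T\<close> satisfies the cone condition because its sum off
  \<open>T\<close> is 0.\<close>

lemma RE_nonneg:
  assumes X: "X \<in> carrier_mat n p" and T: "T \<subseteq> {..<p}" "T \<noteq> {}" and "0 < \<xi>"
  shows "0 \<le> RE X T \<xi>"
proof -
  obtain j where j: "j \<in> T" "j < p" using T by auto
  have "(\<Sum>i\<in>{..<p} - T. \<bar>unit_vec p j $ i :: real\<bar>) = 0"
    using j by (intro sum.neutral) auto
  then have "unit_vec p j \<in> {h. h \<in> carrier_vec (dim_col X) \<and> h \<noteq> 0\<^sub>v (dim_col X) \<and>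
     \<xi> * (\<Sum>j\<in>{..<dim_col X} - T. \<bar>h $ j\<bar>) \<le> 2 * (1 + \<xi>) * sqrt (card T) * norm2 h}"
    using X j \<open>0 < \<xi>\<close> by (simp add: norm2_nonneg)
  then show ?thesis unfolding RE_def
    by (intro cInf_greatest) (auto simp: norm2_nonneg)
qed

text \<open>
  Here \<open>H = \<parallel>h\<parallel>\<close>, \<open>U = \<parallel>X h\<parallel>\<close>, \<open>r = \<parallel>P (\<epsilon> - X h)\<parallel>\<close>, \<open>\<pi> = \<parallel>P \<epsilon>\<parallel>\<close>, \<open>N = \<surd>n\<close>, \<open>K = \<surd>k\<close>; \<open>a\<close>, \<open>b\<close> and \<open>s\<close>
  are the \<open>\<ell>\<^sub>2\<close> norms of \<open>h\<close> on and off \<open>T\<close> and the \<open>\<ell>\<^sub>1\<close> norm off \<open>T\<close>. Outside the cone, \<open>H\<close> has to be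
  bounded through \<open>r\<close>: going through \<open>U\<close> would lose a factor when \<open>R > 1\<close>.
\<close>

lemma lasso_rate_arith:
  fixes \<xi> x \<sigma> L K N R a b H s U q r \<pi> :: real
  assumes pos: "0 < \<xi>" "0 < x" "x < 1" "0 < \<sigma>" "1 \<le> K" "0 < N" "0 < R"
    and L: "2 \<le> L\<^sup>2" "0 < L" and lam: "lam = (1 + \<xi>) * \<sigma> * L"
    and nn: "0 \<le> a" "0 \<le> b" "0 \<le> H" "0 \<le> s" "0 \<le> U" "0 \<le> r" "0 \<le> \<pi>"
    and H: "H\<^sup>2 = a\<^sup>2 + b\<^sup>2"
    and basic: "U\<^sup>2 \<le> q + N * (\<sigma> * K * x * b + \<sigma> * L * s + lam * K * a - lam * s)"
    and q: "q \<le> \<pi> * U" "q - U\<^sup>2 \<le> r * \<pi>" and r: "r * R \<le> lam * K"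
    and \<pi>: "\<pi> \<le> \<sigma> * K + lam / 10"
    and cone: "\<xi> * s \<le> 2 * (1 + \<xi>) * K * H \<Longrightarrow> N * R * H \<le> U"
  shows "max (R * H) (U / N) \<le> (lam * (K + 1 / 10) + \<sigma> * K * (1 + x)) / (N * min 1 R)"
proof -
  define m where "m = min 1 R"
  have m: "0 < m" "m \<le> 1" "m \<le> R" using pos by (auto simp: m_def)
  define S where "S = lam * (K + 1 / 10) + \<sigma> * K * (1 + x)"
  have lam_pos: "0 < lam" using pos L lam by simp
  have sig: "2 * \<sigma>\<^sup>2 \<le> lam\<^sup>2"
  proof -
    have "2 * \<sigma>\<^sup>2 \<le> L\<^sup>2 * \<sigma>\<^sup>2" using L by (intro mult_right_mono) auto
    also have "\<dots> \<le> (1 + \<xi>)\<^sup>2 * (L\<^sup>2 * \<sigma>\<^sup>2)"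
      using mult_right_mono[of 1 "(1 + \<xi>)\<^sup>2" "L\<^sup>2 * \<sigma>\<^sup>2"] pos by simp
    also have "\<dots> = lam\<^sup>2" by (simp add: lam power2_eq_square)
    finally show ?thesis .
  qed
  \<comment> \<open>3/4 is a rational upper bound for 1 / sqrt 2.\<close>
  have sig1: "\<sigma> \<le> 3 / 4 * lam"
  proof (rule power2_le_imp_le)
    show "\<sigma>\<^sup>2 \<le> (3 / 4 * lam)\<^sup>2" 
    proof -
      have "(3 / 4 * lam)\<^sup>2 = 9 / 16 * lam\<^sup>2" by (simp add: power2_eq_square)
      then show ?thesis using sig zero_le_power2[of lam] by linarith
    qed
  qed (use lam_pos in simp)
  have a: "a \<le> H" and b: "b \<le> H"
    by (rule power2_le_imp_le; use H nn in simp)+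
  have \<pi>S: "\<pi> + lam * K + \<sigma> * K * x \<le> S" using \<pi> by (simp add: S_def algebra_simps)
  have rest_nonneg: "0 \<le> lam * K" "0 \<le> \<sigma> * K * x" using pos lam_pos by auto
  \<comment> \<open>As \<open>lam - \<sigma> * L = \<xi> * \<sigma> * L\<close>, the penalty off
    \<open>T\<close> exceeds the thresholded noise by the surplus
    \<open>\<sigma> * L * (\<xi> * s)\<close>.\<close>
  have split: "\<sigma> * K * x * b + \<sigma> * L * s + lam * K * a - lam * s
      = K * (\<sigma> * x * b + lam * a) - \<sigma> * L * (\<xi> * s)"
    by (simp add: lam algebra_simps)
  have "U * m \<le> S \<and> N * R * H * m \<le> S"
  proof (cases "\<xi> * s \<le> 2 * (1 + \<xi>) * K * H")
    case True
    \<comment> \<open>In the cone the surplus is discarded and \<open>m * N * H \<le> U\<close>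
      trades the norm of the error for \<open>U\<close>. Cancelling one factor \<open>U\<close>
      gives the first bound, and \<open>N * R * H \<le> U\<close> then the second.\<close>
    note c = cone[OF True]
    have "K * (\<sigma> * x * b + lam * a) - \<sigma> * L * (\<xi> * s) \<le> K * (\<sigma> * x + lam) * H"
    proof -
      have "\<sigma> * x * b + lam * a \<le> \<sigma> * x * H + lam * H"
        using a b pos lam_pos by (intro add_mono mult_left_mono) auto
      then have "K * (\<sigma> * x * b + lam * a) \<le> K * (\<sigma> * x * H + lam * H)"
        using pos by (intro mult_left_mono) auto
      moreover have "0 \<le> \<sigma> * L * (\<xi> * s)" using pos L nn by simp
      ultimately show ?thesis by (simp add: algebra_simps)
    qed
    then have "N * (\<sigma> * K * x * b + \<sigma> * L * s + lam * K * a - lam * s) \<le> N * (K * (\<sigma> * x + lam) * H)"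
      using pos unfolding split by (intro mult_left_mono) auto
    then have "U\<^sup>2 \<le> \<pi> * U + K * (\<sigma> * x + lam) * (N * H)"
      using basic q(1) by (simp add: algebra_simps)
    then have "m * U\<^sup>2 \<le> m * (\<pi> * U + K * (\<sigma> * x + lam) * (N * H))"
      using m by (intro mult_left_mono) auto
    also have "\<dots> = m * \<pi> * U + K * (\<sigma> * x + lam) * (m * N * H)" by (simp add: algebra_simps)
    also have "\<dots> \<le> 1 * \<pi> * U + K * (\<sigma> * x + lam) * U"
    proof (intro add_mono mult_left_mono mult_right_mono)
      have "m * N * H \<le> R * N * H" using m pos nn by (intro mult_right_mono) auto
      then show "m * N * H \<le> U" using c by (simp add: mult.commute mult.left_commute)
    qed (use m nn pos lam_pos in auto)
    also have "\<dots> = (\<pi> + lam * K + \<sigma> * K * x) * U" by (simp add: algebra_simps)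
    also have "\<dots> \<le> S * U" using \<pi>S nn by (intro mult_right_mono) auto
    finally have "U * (U * m) \<le> U * S" by (simp add: power2_eq_square algebra_simps)
    moreover have "0 \<le> S" using \<pi>S nn rest_nonneg by linarith
    ultimately have "U * m \<le> S" using nn(5) by (cases "U = 0") auto
    moreover have "N * R * H * m \<le> U * m" using c m by (intro mult_right_mono) auto
    ultimately show ?thesis by linarith
  next
    case False
    \<comment> \<open>Cauchy-Schwarz in (a, b): the squared coefficients add up to at most
      \<open>3 / 2 * lam\<^sup>2\<close>, and 3/2 is below the square 25/16 of 5/4.\<close>
    have comb: "\<sigma> * x * b + lam * a \<le> 5 / 4 * lam * H"
    proof (rule power2_le_imp_le)
      have "(\<sigma> * x)\<^sup>2 \<le> \<sigma>\<^sup>2"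
        using pos by (simp add: power_mult_distrib mult_le_cancel_left1 power_le_one)
      moreover have "(5 / 4 * lam)\<^sup>2 = 25 / 16 * lam\<^sup>2" by (simp add: power2_eq_square)
      ultimately have sx: "(\<sigma> * x)\<^sup>2 + lam\<^sup>2 \<le> (5 / 4 * lam)\<^sup>2"
        using sig zero_le_power2[of lam] by linarith
      have "(\<sigma> * x * b + lam * a)\<^sup>2 \<le> ((\<sigma> * x)\<^sup>2 + lam\<^sup>2) * (a\<^sup>2 + b\<^sup>2)"
        using zero_le_power2[of "\<sigma> * x * a - lam * b"] by (simp add: power2_eq_square algebra_simps)
      also have "\<dots> \<le> (5 / 4 * lam)\<^sup>2 * (a\<^sup>2 + b\<^sup>2)" using sx by (intro mult_right_mono) auto
      finally show "(\<sigma> * x * b + lam * a)\<^sup>2 \<le> (5 / 4 * lam * H)\<^sup>2"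
        unfolding H[symmetric] power_mult_distrib[symmetric] .
    qed (use lam_pos nn in auto)
    \<comment> \<open>Outside the cone the surplus is at least \<open>2 * lam * K * H\<close>;
      \<open>comb\<close> consumes 5/4 of \<open>lam * K * H\<close> and 3/4 remains.\<close>
    have "\<sigma> * L * (2 * (1 + \<xi>) * K * H) \<le> \<sigma> * L * (\<xi> * s)"
      using False pos L by (intro mult_left_mono) auto
    moreover have "\<sigma> * L * (2 * (1 + \<xi>) * K * H) = 2 * lam * K * H" by (simp add: lam algebra_simps)
    moreover have "K * (\<sigma> * x * b + lam * a) \<le> K * (5 / 4 * lam * H)"
      using comb pos by (intro mult_left_mono) auto
    ultimately have "K * (\<sigma> * x * b + lam * a) - \<sigma> * L * (\<xi> * s) \<le> - (3 / 4 * lam * K * H)"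
      by (simp add: algebra_simps)
    then have "N * (\<sigma> * K * x * b + \<sigma> * L * s + lam * K * a - lam * s) \<le> N * (- (3 / 4 * lam * K * H))"
      unfolding split using pos by (intro mult_left_mono) auto
    then have neg: "3 / 4 * (N * lam * K * H) \<le> q - U\<^sup>2" using basic by (simp add: algebra_simps)
    have "0 \<le> N * lam * K * H" using pos nn lam_pos by auto
    then have "U\<^sup>2 \<le> \<pi> * U" using neg q(1) by linarith
    then have "U \<le> \<pi>" using nn by (cases "U = 0") (auto simp: power2_eq_square)
    moreover have "U * m \<le> U * 1" using m nn by (intro mult_left_mono) auto
    ultimately have 1: "U * m \<le> S" using \<pi>S rest_nonneg by linarith
    \<comment> \<open>Multiplication by \<open>R\<close> turns \<open>r\<close> into at most
      \<open>lam * K\<close>, which then cancels against the same factor on the left.\<close>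
    have "R * (3 / 4 * (N * lam * K * H)) \<le> R * (r * \<pi>)"
      using neg q(2) pos by (intro mult_left_mono) auto
    also have "\<dots> = (r * R) * \<pi>" by simp
    also have "\<dots> \<le> lam * K * \<pi>" using r nn by (intro mult_right_mono) auto
    finally have "(lam * K) * (3 / 4 * (N * R * H)) \<le> (lam * K) * \<pi>" by (simp add: algebra_simps)
    then have "3 / 4 * (N * R * H) \<le> \<pi>" using lam_pos pos by (simp add: mult_le_cancel_left)
    \<comment> \<open>The factor 3 is what makes \<open>4 / 3 * \<pi>\<close> at most
      \<open>\<pi> + lam * K\<close>, hence at most \<open>S\<close>.\<close>
    moreover have "\<pi> \<le> 3 * (lam * K)"
    proof -
      have "\<sigma> * K \<le> 3 / 4 * lam * K" using sig1 pos by (intro mult_right_mono) auto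
      moreover have "lam * 1 \<le> lam * K" using pos lam_pos by (intro mult_left_mono) auto
      ultimately show ?thesis using \<pi> rest_nonneg by linarith
    qed
    ultimately have "N * R * H \<le> S" using \<pi>S rest_nonneg by linarith
    moreover have "N * R * H * m \<le> N * R * H * 1" using m nn pos by (intro mult_left_mono) auto
    ultimately show ?thesis using 1 by linarith
  qed
  then show ?thesis using m pos unfolding S_def[symmetric] m_def[symmetric]
    by (simp add: field_simps)
qed

section \<open>Control of the noise term and of the penalty\<close>

lemma sum_split:
  fixes f :: "nat \<Rightarrow> real"
  assumes "T \<subseteq> {..<p}"
  shows "(\<Sum>j<p. f j) = (\<Sum>j\<in>T. f j) + (\<Sum>j\<in>{..<p} - T. f j)"
  using sum.subset_diff[OF assms, of f] by simp

text \<open>Split \<open>X h\<close> by \<open>P\<close> and its complement. The complement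
  annihilates the columns in \<open>T\<close>, so only the coordinates of \<open>h\<close> off
  \<open>T\<close> meet the variables \<open>g_tilde\<close>.\<close>

lemma noise_split:
  assumes "regular_design X n p T" and "0 < n" and e: "\<epsilon> \<in> carrier_vec n" and h: "h \<in> carrier_vec p"
  shows "\<epsilon> \<bullet> (X *\<^sub>v h) = (proj_mat X T *\<^sub>v \<epsilon>) \<bullet> (X *\<^sub>v h)
    + sqrt n * (\<Sum>j\<in>{..<p} - T. g_tilde X T \<epsilon> j * h $ j)"
proof -
  interpret regular_design X n p T by fact
  define Q where "Q = 1\<^sub>m n - P"
  have Q: "Q \<in> carrier_mat n n" using P_carrier by (simp add: Q_def minus_carrier_mat)
  define c where "c j = \<epsilon> \<bullet> (Q *\<^sub>v col X j)" for j
  have cX: "col X j \<in> carrier_vec n" for j using X by (metis col_dim carrier_matD(1))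
  have zero: "c j = 0" if "j \<in> T" for j
  proof -
    have "Q *\<^sub>v col X j = 0\<^sub>v n"
      using compl_P_mult[OF cX, of j] P_col[OF that] cX[of j] by (simp add: Q_def)
    then show ?thesis using e by (simp add: c_def)
  qed
  have g: "sqrt n * g_tilde X T \<epsilon> j = c j" if "j < p" for j
    using X that \<open>0 < n\<close> mult_mat_unit_vec[OF X that] by (simp add: g_tilde_def c_def Q_def)
  have Xh: "X *\<^sub>v h \<in> carrier_vec n" using X h by simp
  have QX: "Q * X \<in> carrier_mat n p" using Q X by simp
  have "\<epsilon> \<bullet> (X *\<^sub>v h) - (P *\<^sub>v \<epsilon>) \<bullet> (X *\<^sub>v h) = \<epsilon> \<bullet> (Q *\<^sub>v (X *\<^sub>v h))"
    unfolding Q_def compl_P_mult[OF Xh] P_swap[OF e Xh, symmetric]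
    using e Xh P_mult_carrier[OF Xh] by (simp add: scalar_prod_minus_distrib[of _ n])
  also have "Q *\<^sub>v (X *\<^sub>v h) = (Q * X) *\<^sub>v h"
    by (rule assoc_mult_mat_vec[OF Q X h, symmetric])
  also have "\<epsilon> \<bullet> \<dots> = (\<Sum>i<n. \<Sum>j<p. \<epsilon> $ i * ((Q * X) $$ (i, j) * h $ j))"
    using e QX h by (simp add: scalar_prod_def lessThan_atLeast0 sum_distrib_left del: index_mult_mat)
  also have "\<dots> = (\<Sum>j<p. c j * h $ j)"
  proof (subst sum.swap, intro sum.cong refl)
    fix j assume "j \<in> {..<p}"
    then have "(Q * X) $$ (i, j) = (Q *\<^sub>v col X j) $ i" if "i < n" for i
      using that Q X by simp
    then show "(\<Sum>i<n. \<epsilon> $ i * ((Q * X) $$ (i, j) * h $ j)) = c j * h $ j"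
      using Q by (simp add: c_def scalar_prod_def[of \<epsilon>] lessThan_atLeast0 sum_distrib_right mult.assoc
          del: index_mult_mat index_mult_mat_vec)
  qed
  also have "\<dots> = (\<Sum>j\<in>{..<p} - T. c j * h $ j)"
    using T zero by (simp add: sum_split)
  also have "\<dots> = sqrt n * (\<Sum>j\<in>{..<p} - T. g_tilde X T \<epsilon> j * h $ j)"
    unfolding sum_distrib_left by (intro sum.cong) (auto simp: g[symmetric])
  finally show ?thesis by simp
qed

text \<open>Only the excess of \<open>|\<gamma> j|\<close> over \<open>\<sigma> L\<close> costs an \<open>\<ell>\<^sub>2\<close> norm; the rest is paid for by the penalty.\<close>

lemma thresholded_sum_le:
  fixes \<gamma> h :: "nat \<Rightarrow> real"
  assumes "0 < \<sigma>" "0 \<le> x" "0 \<le> k"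
    and le: "(\<Sum>j\<in>S. (max (\<bar>\<gamma> j\<bar> / \<sigma> - L) 0)\<^sup>2) \<le> k * x\<^sup>2"
  shows "(\<Sum>j\<in>S. \<gamma> j * h j) \<le> \<sigma> * sqrt k * x * L2_set h S + \<sigma> * L * (\<Sum>j\<in>S. \<bar>h j\<bar>)"
proof -
  define m where "m j = max (\<bar>\<gamma> j\<bar> / \<sigma> - L) 0" for j
  have "\<gamma> j * h j \<le> \<sigma> * (\<bar>m j\<bar> * \<bar>h j\<bar>) + \<sigma> * L * \<bar>h j\<bar>" for j
  proof -
    have "\<bar>\<gamma> j\<bar> / \<sigma> \<le> \<bar>m j\<bar> + L" by (simp add: m_def)
    then have "\<bar>\<gamma> j\<bar> \<le> \<sigma> * (\<bar>m j\<bar> + L)" using \<open>0 < \<sigma>\<close> by (simp add: pos_divide_le_eq mult.commute)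
    then have "\<bar>\<gamma> j\<bar> * \<bar>h j\<bar> \<le> \<sigma> * (\<bar>m j\<bar> + L) * \<bar>h j\<bar>" by (intro mult_right_mono) auto
    then show ?thesis using abs_ge_self[of "\<gamma> j * h j"] by (simp add: abs_mult algebra_simps)
  qed
  then have "(\<Sum>j\<in>S. \<gamma> j * h j) \<le> (\<Sum>j\<in>S. \<sigma> * (\<bar>m j\<bar> * \<bar>h j\<bar>) + \<sigma> * L * \<bar>h j\<bar>)"
    by (rule sum_mono)
  also have "\<dots> = \<sigma> * (\<Sum>j\<in>S. \<bar>m j\<bar> * \<bar>h j\<bar>) + \<sigma> * L * (\<Sum>j\<in>S. \<bar>h j\<bar>)"
    by (simp add: sum.distrib sum_distrib_left)
  also have "(\<Sum>j\<in>S. \<bar>m j\<bar> * \<bar>h j\<bar>) \<le> L2_set m S * L2_set h S" by (rule L2_set_mult_ineq)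
  also have "\<dots> \<le> sqrt k * x * L2_set h S"
  proof (intro mult_right_mono)
    have "L2_set m S \<le> sqrt (k * x\<^sup>2)" using le by (simp add: L2_set_def m_def)
    then show "L2_set m S \<le> sqrt k * x" using assms(2) by (simp add: real_sqrt_mult)
  qed simp
  finally show ?thesis using \<open>0 < \<sigma>\<close> by (simp add: algebra_simps)
qed

text \<open>Off \<open>T\<close> the vector \<open>b\<close> vanishes, so the difference there is
  exactly minus the error; on \<open>T\<close> the triangle inequality and Cauchy-Schwarz
  apply.\<close>

lemma norm1_diff_le:
  assumes b: "b \<in> carrier_vec p" "b' \<in> carrier_vec p" and T: "T = vec_support b"
  shows "norm1 b - norm1 b'
    \<le> sqrt (card T) * L2_set (\<lambda>j. (b' - b) $ j) T - (\<Sum>j\<in>{..<p} - T. \<bar>(b' - b) $ j\<bar>)"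
proof -
  let ?h = "\<lambda>j. (b' - b) $ j"
  have T': "T \<subseteq> {..<p}" using b T by (auto simp: vec_support_def)
  have "norm1 b - norm1 b' = (\<Sum>j<p. \<bar>b $ j\<bar> - \<bar>b' $ j\<bar>)"
    using b by (simp add: norm1_def sum_subtractf)
  also have "\<dots> \<le> (\<Sum>j\<in>T. \<bar>?h j\<bar>) + (\<Sum>j\<in>{..<p} - T. - \<bar>?h j\<bar>)"
    unfolding sum_split[OF T'] using b T' by (intro add_mono sum_mono) (auto simp: T vec_support_def)
  also have "(\<Sum>j\<in>T. \<bar>?h j\<bar>) \<le> sqrt (card T) * L2_set ?h T" by (rule sum_abs_le_sqrt_card_L2_set)
  finally show ?thesis by (simp add: sum_negf)
qed

text \<open>With \<open>k \<le> p\<close> the argument of the logarithm is at least e. The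
  deterministic half uses this as \<open>2 \<le> L\<^sup>2\<close>, the probabilistic half as
  \<open>0 < L\<close>.\<close>

lemma ln_ratio_ge_1:
  assumes "1 \<le> k" "k \<le> p"
  shows "1 \<le> ln (exp 1 * real p / real k)"
proof -
  have "exp 1 * 1 \<le> exp 1 * (real p / real k)" using assms by (intro mult_left_mono) auto
  then have "ln (exp 1) \<le> ln (exp 1 * real p / real k)" using assms by (subst ln_le_cancel_iff) auto
  then show ?thesis by simp
qed

text \<open>The reading of the bound as infinity when its denominator vanishes. Positivity of the
  numerator matters because \<open>0 / 0\<close> is \<open>0\<close> in
  \<open>ereal\<close>.\<close>

lemma ereal_le_divide_0:
  assumes "0 < (a :: real)"
  shows "y \<le> ereal a / ereal 0"
  using assms by (simp add: divide_ereal_def)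

lemma lasso_bound:
  assumes pos: "0 < \<xi>" "0 < x" "x < 1" "0 < \<sigma>"
    and X: "X \<in> carrier_mat n p" and \<beta>: "\<beta> \<in> carrier_vec p" and \<epsilon>: "\<epsilon> \<in> carrier_vec n"
    and y: "y = X *\<^sub>v \<beta> + \<epsilon>" and T: "T = vec_support \<beta>" and k: "k = card T" "1 \<le> k"
    and inv: "invertible_mat (gram X T)" and lam: "lam = lasso_lambda \<xi> \<sigma> p k"
    and argmin: "is_arg_min (lasso_objective X y lam) (\<lambda>b. b \<in> carrier_vec p) b"
    and \<Omega>: "Omega_cond \<xi> x \<sigma> T X \<epsilon>"
  shows "ereal (max (RE X T \<xi> * norm2 (b - \<beta>)) (norm2 (X *\<^sub>v (b - \<beta>)) / sqrt n))
          \<le> ereal (lam * (sqrt k + 1 / 10) + \<sigma> * sqrt k * (1 + x))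
              / ereal (sqrt n * min 1 (RE X T \<xi>))"
proof -
  have Tp: "T \<subseteq> {..<p}" using \<beta> T by (auto simp: vec_support_def)
  interpret D: regular_design X n p T using X Tp inv by unfold_locales
  have dimX: "dim_row X = n" "dim_col X = p" using X by auto
  have b: "b \<in> carrier_vec p" using argmin by (simp add: is_arg_min_def)
  have "T \<noteq> {}" "finite T" using k Tp finite_subset by auto
  define L where "L = sqrt (2 * ln (exp 1 * real p / real k))"
  define K where "K = sqrt k"
  define R where "R = RE X T \<xi>"
  have "k \<le> p" using k Tp card_mono[OF _ Tp] by simp
  then have ln1: "1 \<le> ln (exp 1 * real p / real k)" using k by (intro ln_ratio_ge_1)
  then have L2: "2 \<le> L\<^sup>2" "0 < L" by (auto simp: L_def)
  have K1: "1 \<le> K" using k by (simp add: K_def)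
  have lamL: "lam = (1 + \<xi>) * \<sigma> * L" by (simp add: lam lasso_lambda_def L_def)
  then have lam_pos: "0 < lam" using pos L2 by simp
  define S where "S = lam * (K + 1 / 10) + \<sigma> * K * (1 + x)"
  have S: "0 < S" using lam_pos K1 pos by (auto simp: S_def intro!: add_pos_pos mult_pos_pos)
  have R: "0 \<le> R" unfolding R_def using X Tp \<open>T \<noteq> {}\<close> pos(1) by (rule RE_nonneg)
  show ?thesis
  \<comment> \<open>For \<open>n = 0\<close> the factor \<open>sqrt n\<close> vanishes, so this case
    falls together with \<open>R = 0\<close>: the right side is infinite.\<close>
  proof (cases "n = 0 \<or> R = 0")
    case True
    then have "sqrt n * min 1 R = 0" by auto
    then show ?thesis unfolding R_def[symmetric] K_def[symmetric] S_def[symmetric]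
      using ereal_le_divide_0[OF S] by simp
  next
    case False
    then have n: "0 < n" and Rpos: "0 < R" using R by auto
    define h where "h = b - \<beta>"
    define u where "u = X *\<^sub>v h"
    define r where "r = \<epsilon> - u"
    have h: "h \<in> carrier_vec p" using b \<beta> by (simp add: h_def)
    have u: "u \<in> carrier_vec n" using X h by (simp add: u_def)
    have r: "r \<in> carrier_vec n" using \<epsilon> u by (simp add: r_def)
    have yc: "y \<in> carrier_vec n" using X \<beta> \<epsilon> by (simp add: y)
    have r_eq: "y - X *\<^sub>v b = r"
      using X b \<beta> \<epsilon> by (intro eq_vecI) (auto simp: r_def u_def h_def y mult_minus_distrib_mat_vec[of _ n p])
    have opt: "r \<bullet> (X *\<^sub>v v) \<le> sqrt n * lam * (norm1 (b + v) - norm1 b)" if "v \<in> carrier_vec p" for v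
      using lasso_optimality[OF X yc _ argmin that] lam_pos unfolding r_eq by simp
    let ?P = "proj_mat X T"
    note Pe = D.P_mult_carrier[OF \<epsilon>] and Pu = D.P_mult_carrier[OF u] and Pr = D.P_mult_carrier[OF r]
    define s where "s = (\<Sum>j\<in>{..<p} - T. \<bar>h $ j\<bar>)"
    define q where "q = (?P *\<^sub>v \<epsilon>) \<bullet> u"

    have Pe_eq: "?P *\<^sub>v r = ?P *\<^sub>v \<epsilon> - ?P *\<^sub>v u"
      unfolding r_def by (rule mult_minus_distrib_mat_vec[OF D.P_carrier \<epsilon> u])

    have H: "(norm2 h)\<^sup>2 = (L2_set (($) h) T)\<^sup>2 + (L2_set (($) h) ({..<p} - T))\<^sup>2"
    proof -
      have "(norm2 h)\<^sup>2 = (\<Sum>j<p. (h $ j)\<^sup>2)" using h by (simp add: norm2_def sum_nonneg)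
      then show ?thesis unfolding sum_split[OF Tp] by (simp add: L2_set_def sum_nonneg)
    qed

    have basic: "(norm2 u)\<^sup>2 \<le> q + sqrt n * (\<sigma> * K * x * L2_set (($) h) ({..<p} - T) + \<sigma> * L * s
        + lam * K * L2_set (($) h) T - lam * s)"
    proof -
      \<comment> \<open>The direction \<open>- h\<close> leads from the estimator back to
        \<open>\<beta>\<close>.\<close>
      have "r \<bullet> (X *\<^sub>v (- h)) \<le> sqrt n * lam * (norm1 (b + - h) - norm1 b)"
        using h by (intro opt) simp
      moreover have "b + - h = \<beta>" using b \<beta> by (intro eq_vecI) (auto simp: h_def)
      moreover have "X *\<^sub>v (- h) = - u"
        using X h by (intro eq_vecI) (auto simp: u_def)
      ultimately have "u \<bullet> u - \<epsilon> \<bullet> u \<le> sqrt n * lam * (norm1 \<beta> - norm1 b)"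
        using r u \<epsilon> by (simp add: r_def minus_scalar_prod_distrib[of _ n])
      also have "\<dots> \<le> sqrt n * lam * (K * L2_set (($) h) T - s)"
        using norm1_diff_le[OF \<beta> b T] k lam_pos
        by (intro mult_left_mono) (auto simp: h_def K_def s_def)
      finally have 1: "(norm2 u)\<^sup>2 \<le> \<epsilon> \<bullet> u + sqrt n * (lam * (K * L2_set (($) h) T - s))"
        by (simp add: norm2_power2 algebra_simps)
      have "\<epsilon> \<bullet> u = q + sqrt n * (\<Sum>j\<in>{..<p} - T. g_tilde X T \<epsilon> j * h $ j)"
        unfolding u_def q_def by (rule noise_split[OF D.regular_design_axioms n \<epsilon> h])
      also have "(\<Sum>j\<in>{..<p} - T. g_tilde X T \<epsilon> j * h $ j)
          \<le> \<sigma> * K * x * L2_set (($) h) ({..<p} - T) + \<sigma> * L * s"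
        unfolding K_def s_def using \<Omega> pos
        by (intro thresholded_sum_le) (auto simp: Omega_cond_def dimX L_def k)
      finally have 2: "\<epsilon> \<bullet> u \<le> q + sqrt n * (\<sigma> * K * x * L2_set (($) h) ({..<p} - T) + \<sigma> * L * s)"
        by (simp add: mult_left_mono)
      from 1 2 show ?thesis by (simp add: algebra_simps)
    qed

    have q1: "q \<le> norm2 (?P *\<^sub>v \<epsilon>) * norm2 u"
      unfolding q_def by (rule scalar_prod_le_norm2[OF Pe u])
    have q2: "q - (norm2 u)\<^sup>2 \<le> norm2 (?P *\<^sub>v r) * norm2 (?P *\<^sub>v \<epsilon>)"
    proof -
      have "q = (?P *\<^sub>v \<epsilon>) \<bullet> (?P *\<^sub>v u)"
        unfolding q_def using D.P_swap[OF Pe u] D.P_twice[OF \<epsilon>] by simp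
      moreover have "(norm2 (?P *\<^sub>v u))\<^sup>2 \<le> (norm2 u)\<^sup>2"
        using D.norm2_compl_P[OF u] zero_le_power2[of "norm2 (u - ?P *\<^sub>v u)"] by linarith
      \<comment> \<open>Both sides equal the inner product of \<open>P u\<close> and
        \<open>P r\<close>, since \<open>P r = P \<epsilon> - P u\<close>.\<close>
      moreover have "(?P *\<^sub>v \<epsilon>) \<bullet> (?P *\<^sub>v u) - (norm2 (?P *\<^sub>v u))\<^sup>2
          = (?P *\<^sub>v r) \<bullet> (?P *\<^sub>v \<epsilon>) - (norm2 (?P *\<^sub>v r))\<^sup>2"
        unfolding norm2_power2 Pe_eq using Pe Pu
        by (simp add: minus_scalar_prod_distrib[of _ n] scalar_prod_minus_distrib[of _ n]
            comm_scalar_prod[OF Pu Pe])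
      ultimately show ?thesis
        using scalar_prod_le_norm2[OF Pr Pe] zero_le_power2[of "norm2 (?P *\<^sub>v r)"] by linarith
    qed

    have PrR: "norm2 (?P *\<^sub>v r) * R \<le> lam * K"
    proof -
      obtain v where v: "v \<in> carrier_vec p" "\<And>j. j < p \<Longrightarrow> j \<notin> T \<Longrightarrow> v $ j = 0" "?P *\<^sub>v r = X *\<^sub>v v"
        using D.P_range[OF r] by metis
      \<comment> \<open>Because \<open>v\<close> vanishes off \<open>T\<close>, it lies in the cone,
        which bounds \<open>norm2 v\<close> by the norm of \<open>P r\<close>; and its l1 norm is at
        most \<open>K * norm2 v\<close>, which bounds the penalty increment.\<close>
      have out: "(\<Sum>j\<in>{..<p} - T. \<bar>v $ j\<bar>) = 0" using v by (intro sum.neutral) auto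
      have "norm1 (b + v) - norm1 b \<le> norm1 v"
        using b v by (simp add: norm1_def flip: sum_subtractf) (intro sum_mono, simp)
      also have "norm1 v = (\<Sum>j\<in>T. \<bar>v $ j\<bar>)" using v(1) out by (simp add: norm1_def sum_split[OF Tp])
      also have "\<dots> \<le> K * L2_set (($) v) T" unfolding K_def k by (rule sum_abs_le_sqrt_card_L2_set)
      also have "\<dots> \<le> K * norm2 v"
        using K1 v(1) Tp by (intro mult_left_mono) (auto simp: norm2_def L2_set_def intro!: sum_mono2)
      finally have "sqrt n * lam * (norm1 (b + v) - norm1 b) \<le> sqrt n * lam * (K * norm2 v)"
        using lam_pos by (intro mult_left_mono) auto
      moreover have "r \<bullet> (X *\<^sub>v v) = (norm2 (?P *\<^sub>v r))\<^sup>2"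
        unfolding v(3)[symmetric] by (rule D.norm2_P_power2[OF r, symmetric])
      ultimately have 1: "(norm2 (?P *\<^sub>v r))\<^sup>2 \<le> sqrt n * lam * (K * norm2 v)"
        using opt[OF v(1)] by simp
      have 2: "sqrt n * R * norm2 v \<le> norm2 (?P *\<^sub>v r)"
        unfolding R_def v(3) using out pos
        by (intro RE_le[OF X n v(1)]) (auto simp: norm2_nonneg)
      have "(norm2 (?P *\<^sub>v r))\<^sup>2 * R \<le> (sqrt n * lam * (K * norm2 v)) * R"
        using 1 R by (rule mult_right_mono)
      also have "\<dots> = lam * K * (sqrt n * R * norm2 v)" by (simp add: algebra_simps)
      also have "\<dots> \<le> lam * K * norm2 (?P *\<^sub>v r)" using 2 lam_pos K1 by (intro mult_left_mono) auto
      finally have "norm2 (?P *\<^sub>v r) * (norm2 (?P *\<^sub>v r) * R) \<le> norm2 (?P *\<^sub>v r) * (lam * K)"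
        by (simp add: power2_eq_square algebra_simps)
      then show ?thesis using norm2_nonneg[of "?P *\<^sub>v r"] lam_pos K1
        by (cases "norm2 (?P *\<^sub>v r) = 0") auto
    qed

    have "max (R * norm2 h) (norm2 u / sqrt n) \<le> S / (sqrt n * min 1 R)"
      unfolding S_def
    proof (rule lasso_rate_arith[OF pos K1 _ Rpos L2 lamL _ _ _ _ _ _ _ H basic q1 q2 PrR])
      show "norm2 (?P *\<^sub>v \<epsilon>) \<le> \<sigma> * K + lam / 10"
        using \<Omega> unfolding Omega_cond_def by (simp add: dimX K_def lam k)
      show "sqrt n * R * norm2 h \<le> norm2 u" if "\<xi> * s \<le> 2 * (1 + \<xi>) * K * norm2 h"
        using RE_le[OF X n h, of \<xi> T] that by (simp add: u_def R_def s_def K_def k)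
    qed (auto simp: n norm2_nonneg s_def intro!: sum_nonneg)
    then show ?thesis
      unfolding R_def[symmetric] K_def[symmetric] S_def[symmetric] h_def[symmetric] u_def[symmetric]
      using n Rpos S by simp
  qed
qed

section \<open>Measurability\<close>

text \<open>Measurability entry by entry with constant dimensions, a form that passes easily through
  the matrix operations occurring in \<open>Omega_cond\<close>.\<close>

definition measurable_mat :: "'a measure \<Rightarrow> nat \<Rightarrow> nat \<Rightarrow> ('a \<Rightarrow> real mat) \<Rightarrow> bool" where
  "measurable_mat M n p Z \<longleftrightarrow> (\<forall>\<omega>\<in>space M. Z \<omega> \<in> carrier_mat n p) \<and>
     (\<forall>i<n. \<forall>j<p. (\<lambda>\<omega>. Z \<omega> $$ (i, j)) \<in> borel_measurable M)"

definition measurable_vec :: "'a measure \<Rightarrow> nat \<Rightarrow> ('a \<Rightarrow> real vec) \<Rightarrow> bool" where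
  "measurable_vec M n v \<longleftrightarrow> (\<forall>\<omega>\<in>space M. v \<omega> \<in> carrier_vec n) \<and>
     (\<forall>i<n. (\<lambda>\<omega>. v \<omega> $ i) \<in> borel_measurable M)"

lemma measurable_matI:
  assumes "\<And>\<omega>. \<omega> \<in> space M \<Longrightarrow> Z \<omega> \<in> carrier_mat n p"
    and "\<And>i j. i < n \<Longrightarrow> j < p \<Longrightarrow> f i j \<in> borel_measurable M"
    and "\<And>i j \<omega>. \<omega> \<in> space M \<Longrightarrow> i < n \<Longrightarrow> j < p \<Longrightarrow> Z \<omega> $$ (i, j) = f i j \<omega>"
  shows "measurable_mat M n p Z"
  unfolding measurable_mat_def using assms measurable_cong[of M "\<lambda>\<omega>. Z \<omega> $$ (_, _)"] by (metis (no_types, lifting))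

lemma measurable_vecI:
  assumes "\<And>\<omega>. \<omega> \<in> space M \<Longrightarrow> v \<omega> \<in> carrier_vec n"
    and "\<And>i. i < n \<Longrightarrow> f i \<in> borel_measurable M"
    and "\<And>i \<omega>. \<omega> \<in> space M \<Longrightarrow> i < n \<Longrightarrow> v \<omega> $ i = f i \<omega>"
  shows "measurable_vec M n v"
  unfolding measurable_vec_def using assms measurable_cong[of M "\<lambda>\<omega>. v \<omega> $ _"] by (metis (no_types, lifting))

lemma measurable_matD:
  assumes "measurable_mat M n p Z"
  shows "\<omega> \<in> space M \<Longrightarrow> Z \<omega> \<in> carrier_mat n p"
    and "i < n \<Longrightarrow> j < p \<Longrightarrow> (\<lambda>\<omega>. Z \<omega> $$ (i, j)) \<in> borel_measurable M"
  using assms by (auto simp: measurable_mat_def)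

lemma measurable_vecD:
  assumes "measurable_vec M n v"
  shows "\<omega> \<in> space M \<Longrightarrow> v \<omega> \<in> carrier_vec n"
    and "i < n \<Longrightarrow> (\<lambda>\<omega>. v \<omega> $ i) \<in> borel_measurable M"
  using assms by (auto simp: measurable_vec_def)

lemma measurable_mat_dims:
  assumes "measurable_mat M n p Z" "\<omega> \<in> space M"
  shows "dim_row (Z \<omega>) = n" "dim_col (Z \<omega>) = p"
  using measurable_matD(1)[OF assms] by auto

lemma measurable_vec_dim:
  assumes "measurable_vec M n v" "\<omega> \<in> space M"
  shows "dim_vec (v \<omega>) = n"
  using measurable_vecD(1)[OF assms] by auto

lemma measurable_mat_const: "A \<in> carrier_mat n p \<Longrightarrow> measurable_mat M n p (\<lambda>_. A)"
  by (simp add: measurable_mat_def)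

lemma measurable_vec_const: "v \<in> carrier_vec n \<Longrightarrow> measurable_vec M n (\<lambda>_. v)"
  by (simp add: measurable_vec_def)

lemma measurable_mat_transpose:
  assumes "measurable_mat M n p Z"
  shows "measurable_mat M p n (\<lambda>\<omega>. transpose_mat (Z \<omega>))"
  by (rule measurable_matI[where f = "\<lambda>i j \<omega>. Z \<omega> $$ (j, i)"])
    (use measurable_matD[OF assms] measurable_mat_dims[OF assms] in auto)

lemma measurable_mat_mult:
  assumes Z: "measurable_mat M n m Z" and W: "measurable_mat M m p W"
  shows "measurable_mat M n p (\<lambda>\<omega>. Z \<omega> * W \<omega>)"
proof (rule measurable_matI[where f = "\<lambda>i j \<omega>. \<Sum>l<m. Z \<omega> $$ (i, l) * W \<omega> $$ (l, j)"])
  show "(\<lambda>\<omega>. \<Sum>l<m. Z \<omega> $$ (i, l) * W \<omega> $$ (l, j)) \<in> borel_measurable M" if "i < n" "j < p" for i j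
    using that measurable_matD(2)[OF Z] measurable_matD(2)[OF W] by (intro borel_measurable_sum borel_measurable_times) auto
next
  fix i j \<omega> assume "\<omega> \<in> space M" "i < n" "j < p"
  then show "(Z \<omega> * W \<omega>) $$ (i, j) = (\<Sum>l<m. Z \<omega> $$ (i, l) * W \<omega> $$ (l, j))"
    using measurable_matD(1)[OF Z, of \<omega>] measurable_matD(1)[OF W, of \<omega>]
    by (auto simp: scalar_prod_def lessThan_atLeast0)
qed (rule mult_carrier_mat[OF measurable_matD(1)[OF Z] measurable_matD(1)[OF W]])

lemma measurable_mat_minus:
  assumes Z: "measurable_mat M n p Z" and W: "measurable_mat M n p W"
  shows "measurable_mat M n p (\<lambda>\<omega>. Z \<omega> - W \<omega>)"
proof (rule measurable_matI[where f = "\<lambda>i j \<omega>. Z \<omega> $$ (i, j) - W \<omega> $$ (i, j)"])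
  fix i j \<omega> assume "\<omega> \<in> space M" "i < n" "j < p"
  then show "(Z \<omega> - W \<omega>) $$ (i, j) = Z \<omega> $$ (i, j) - W \<omega> $$ (i, j)"
    using measurable_matD(1)[OF Z, of \<omega>] measurable_matD(1)[OF W, of \<omega>] by auto
qed (use measurable_matD[OF Z] measurable_matD[OF W] in \<open>auto intro!: minus_carrier_mat borel_measurable_diff\<close>)

lemma measurable_vec_mult:
  assumes Z: "measurable_mat M n p Z" and v: "measurable_vec M p v"
  shows "measurable_vec M n (\<lambda>\<omega>. Z \<omega> *\<^sub>v v \<omega>)"
proof (rule measurable_vecI[where f = "\<lambda>i \<omega>. \<Sum>l<p. Z \<omega> $$ (i, l) * v \<omega> $ l"])
  show "(\<lambda>\<omega>. \<Sum>l<p. Z \<omega> $$ (i, l) * v \<omega> $ l) \<in> borel_measurable M" if "i < n" for i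
    using that measurable_matD(2)[OF Z] measurable_vecD(2)[OF v] by (intro borel_measurable_sum borel_measurable_times) auto
next
  fix i \<omega> assume "\<omega> \<in> space M" "i < n"
  then show "(Z \<omega> *\<^sub>v v \<omega>) $ i = (\<Sum>l<p. Z \<omega> $$ (i, l) * v \<omega> $ l)"
    using measurable_matD(1)[OF Z, of \<omega>] measurable_vecD(1)[OF v, of \<omega>]
    by (auto simp: scalar_prod_def lessThan_atLeast0)
qed (use measurable_matD(1)[OF Z] measurable_vecD(1)[OF v] in \<open>auto intro!: mult_mat_vec_carrier\<close>)

lemma borel_measurable_scalar_prod:
  assumes v: "measurable_vec M n v" and w: "measurable_vec M n w"
  shows "(\<lambda>\<omega>. v \<omega> \<bullet> w \<omega>) \<in> borel_measurable M"
proof -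
  have "(\<lambda>\<omega>. \<Sum>i<n. v \<omega> $ i * w \<omega> $ i) \<in> borel_measurable M"
    using measurable_vecD(2)[OF v] measurable_vecD(2)[OF w] by (intro borel_measurable_sum borel_measurable_times) auto
  then show ?thesis
    by (rule measurable_cong[THEN iffD1, rotated])
      (use measurable_vec_dim[OF w] in \<open>auto simp: scalar_prod_def lessThan_atLeast0\<close>)
qed

lemma borel_measurable_norm2:
  assumes v: "measurable_vec M n v"
  shows "(\<lambda>\<omega>. norm2 (v \<omega>)) \<in> borel_measurable M"
proof -
  have "norm2 w = sqrt (w \<bullet> w)" for w by (simp flip: norm2_power2 add: norm2_nonneg)
  then show ?thesis using borel_measurable_scalar_prod[OF v v] by simp
qed

text \<open>By the Leibniz formula the determinant is a polynomial in the entries.\<close>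

lemma borel_measurable_det:
  assumes Z: "measurable_mat M k k Z"
  shows "(\<lambda>\<omega>. det (Z \<omega>)) \<in> borel_measurable M"
proof -
  have "(\<lambda>\<omega>. \<Sum>p\<in>{p. p permutes {0..<k}}. signof p * (\<Prod>i = 0..<k. Z \<omega> $$ (i, p i))) \<in> borel_measurable M"
    using measurable_matD(2)[OF Z]
    by (intro borel_measurable_sum borel_measurable_times borel_measurable_prod borel_measurable_const)
      (auto dest: permutes_in_image)
  then show ?thesis
    by (rule measurable_cong[THEN iffD1, rotated])
      (use measurable_mat_dims[OF Z] in \<open>auto simp: det_def\<close>)
qed

lemma measurable_mat_delete:
  assumes Z: "measurable_mat M k k Z" and ij: "i < k" "j < k"
  shows "measurable_mat M (k - 1) (k - 1) (\<lambda>\<omega>. mat_delete (Z \<omega>) i j)"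
proof (rule measurable_matI[where f = "\<lambda>a b \<omega>. Z \<omega> $$ (if a < i then a else Suc a, if b < j then b else Suc b)"])
  show "(\<lambda>\<omega>. Z \<omega> $$ (if a < i then a else Suc a, if b < j then b else Suc b)) \<in> borel_measurable M"
    if "a < k - 1" "b < k - 1" for a b
    using that by (intro measurable_matD(2)[OF Z]) auto
qed (use measurable_mat_dims[OF Z] in \<open>auto simp: mat_delete_def intro!: carrier_matI\<close>)

text \<open>Each entry is a rational function where the determinant is nonzero and 0 on the
  measurable set where it vanishes, so no invertibility has to be assumed.\<close>

lemma measurable_inv_mat:
  assumes Z: "measurable_mat M k k Z"
  shows "measurable_mat M k k (\<lambda>\<omega>. inv_mat (Z \<omega>))"
proof (rule measurable_matI[where f = "\<lambda>i j \<omega>. if det (Z \<omega>) = 0 then 0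
    else 1 / det (Z \<omega>) * ((-1) ^ (j + i) * det (mat_delete (Z \<omega>) j i))"])
  fix i j assume ij: "i < k" "j < k"
  have [measurable]: "(\<lambda>\<omega>. det (Z \<omega>)) \<in> borel_measurable M"
    "(\<lambda>\<omega>. det (mat_delete (Z \<omega>) j i)) \<in> borel_measurable M"
    using borel_measurable_det[OF Z] borel_measurable_det[OF measurable_mat_delete[OF Z ij(2,1)]] by auto
  show "(\<lambda>\<omega>. if det (Z \<omega>) = 0 then 0
    else 1 / det (Z \<omega>) * ((-1) ^ (j + i) * det (mat_delete (Z \<omega>) j i))) \<in> borel_measurable M"
    by measurable
next
  fix i j \<omega> assume w: "\<omega> \<in> space M" and ij: "i < k" "j < k"
  note c = measurable_matD(1)[OF Z w]
  show "inv_mat (Z \<omega>) $$ (i, j) = (if det (Z \<omega>) = 0 then 0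
    else 1 / det (Z \<omega>) * ((-1) ^ (j + i) * det (mat_delete (Z \<omega>) j i)))"
    using ij c inv_mat_singular[OF c] inv_mat_eq_adj_mat[OF c]
    by (auto simp: adj_mat_def cofactor_def)
next
  fix \<omega> assume w: "\<omega> \<in> space M"
  note c = measurable_matD(1)[OF Z w]
  show "inv_mat (Z \<omega>) \<in> carrier_mat k k"
    using inv_mat_singular[OF c] inv_mat_eq_adj_mat[OF c] adj_mat(1)[OF c]
    by (cases "det (Z \<omega>) = 0") auto
qed

lemma measurable_cols_submatrix:
  assumes Z: "measurable_mat M n p Z" and T: "T \<subseteq> {..<p}"
  shows "measurable_mat M n (card T) (\<lambda>\<omega>. cols_submatrix (Z \<omega>) T)"
proof (rule measurable_matI[where f = "\<lambda>i m \<omega>. Z \<omega> $$ (i, pick T m)"])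
  show "(\<lambda>\<omega>. Z \<omega> $$ (i, pick T m)) \<in> borel_measurable M" if "i < n" "m < card T" for i m
    using that pick_less[of "0\<^sub>m n p" n p T m] T by (intro measurable_matD(2)[OF Z]) auto
qed (use cols_submatrix_carrier[OF measurable_matD(1)[OF Z] T] cols_submatrix_index[OF measurable_matD(1)[OF Z] T] in auto)

lemma measurable_proj_mat:
  assumes Z: "measurable_mat M n p Z" and T: "T \<subseteq> {..<p}"
  shows "measurable_mat M n n (\<lambda>\<omega>. proj_mat (Z \<omega>) T)"
  unfolding proj_mat_def gram_def
  by (intro measurable_mat_mult[of _ n "card T"] measurable_mat_mult[of _ "card T" n] measurable_inv_mat
      measurable_mat_transpose measurable_cols_submatrix[OF Z T])

text \<open>Stated for an arbitrary space \<open>M\<close>, so that it applies both to the two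
  projections of a product space and to the random design and noise themselves.\<close>

lemma pred_Omega_cond:
  assumes Z: "measurable_mat M n p Z" and e: "measurable_vec M n e" and T: "T \<subseteq> {..<p}"
  shows "Measurable.pred M (\<lambda>\<omega>. Omega_cond \<xi> x \<sigma> T (Z \<omega>) (e \<omega>))"
proof -
  note P = measurable_proj_mat[OF Z T]
  define g where "g j \<omega> = (e \<omega> \<bullet> ((1\<^sub>m n - proj_mat (Z \<omega>) T) *\<^sub>v (Z \<omega> *\<^sub>v unit_vec p j))) / sqrt n" for j \<omega>
  have [measurable]: "g j \<in> borel_measurable M" for j
    unfolding g_def
    by (intro borel_measurable_divide borel_measurable_const borel_measurable_scalar_prod[OF e]
        measurable_vec_mult[of _ n n] measurable_vec_mult[OF Z] measurable_mat_minus P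
        measurable_mat_const measurable_vec_const) auto
  have [measurable]: "(\<lambda>\<omega>. norm2 (proj_mat (Z \<omega>) T *\<^sub>v e \<omega>)) \<in> borel_measurable M"
    by (rule borel_measurable_norm2[OF measurable_vec_mult[OF P e]])
  have "Measurable.pred M (\<lambda>\<omega>.
     (\<Sum>j\<in>{..<p} - T. (max (\<bar>g j \<omega>\<bar> / \<sigma> - sqrt (2 * ln (exp 1 * real p / real (card T)))) 0)\<^sup>2)
       \<le> real (card T) * x\<^sup>2 \<and>
     norm2 (proj_mat (Z \<omega>) T *\<^sub>v e \<omega>) \<le> \<sigma> * sqrt (card T) + 1 / 10 * lasso_lambda \<xi> \<sigma> p (card T))"
    by measurable
  then show ?thesis
    by (rule measurable_cong[THEN iffD1, rotated])
      (use measurable_mat_dims[OF Z] in \<open>simp add: Omega_cond_def g_tilde_def g_def\<close>)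
qed

section \<open>From the transported Borel sigma-algebras to entrywise measurability\<close>

lemma measurable_mat_borel_mat:
  assumes "f \<in> measurable M (borel_mat n p)" shows "measurable_mat M n p f"
proof (rule measurable_matI[where f = "\<lambda>i j \<omega>. f \<omega> $$ (i, j)"])
  show "f \<omega> \<in> carrier_mat n p" if "\<omega> \<in> space M" for \<omega>
    using measurable_space[OF assms that] by (simp add: borel_mat_def)
next
  fix i j assume ij: "i < n" "j < p"
  have "(\<lambda>A. (\<lambda>ij\<in>{..<n} \<times> {..<p}. A $$ ij) (i, j)) \<in> borel_measurable (borel_mat n p)"
    unfolding borel_mat_def using ij
    by (intro measurable_compose[OF measurable_vimage_algebra1 measurable_component_singleton])
      (auto simp: space_PiM split: if_splits)
  then have "(\<lambda>A. A $$ (i, j)) \<in> borel_measurable (borel_mat n p)" using ij by simp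
  from measurable_compose[OF assms this] show "(\<lambda>\<omega>. f \<omega> $$ (i, j)) \<in> borel_measurable M" .
qed simp

lemma measurable_vec_borel_vec:
  assumes "f \<in> measurable M (borel_vec n)" shows "measurable_vec M n f"
proof (rule measurable_vecI[where f = "\<lambda>i \<omega>. f \<omega> $ i"])
  show "f \<omega> \<in> carrier_vec n" if "\<omega> \<in> space M" for \<omega>
    using measurable_space[OF assms that] by (simp add: borel_vec_def)
next
  fix i assume i: "i < n"
  have "(\<lambda>v. (\<lambda>i\<in>{..<n}. v $ i) i) \<in> borel_measurable (borel_vec n)"
    unfolding borel_vec_def using i
    by (intro measurable_compose[OF measurable_vimage_algebra1 measurable_component_singleton])
      (auto simp: space_PiM split: if_splits)
  then have "(\<lambda>v. v $ i) \<in> borel_measurable (borel_vec n)" using i by simp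
  from measurable_compose[OF assms this] show "(\<lambda>\<omega>. f \<omega> $ i) \<in> borel_measurable M" .
qed simp

section \<open>Gaussian noise\<close>

definition normal_moment :: "real \<Rightarrow> nat \<Rightarrow> real" where
  "normal_moment \<sigma> a = (\<integral>x. normal_density 0 \<sigma> x * x ^ a \<partial>lborel)"

lemma normal_moment_values:
  assumes "0 < \<sigma>"
  shows "normal_moment \<sigma> 0 = 1" "normal_moment \<sigma> (Suc 0) = 0" "normal_moment \<sigma> 2 = \<sigma>\<^sup>2"
    "normal_moment \<sigma> 3 = 0" "normal_moment \<sigma> 4 = 3 * \<sigma> ^ 4"
proof -
  note odd = integral_normal_moment_odd[OF assms, of 0] and even = integral_normal_moment_even[OF assms, of 0]
  show "normal_moment \<sigma> 0 = 1" using even[of 0] by (simp add: normal_moment_def)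
  show "normal_moment \<sigma> (Suc 0) = 0" using odd[of 0] by (simp add: normal_moment_def)
  show "normal_moment \<sigma> 2 = \<sigma>\<^sup>2" using even[of 1] by (simp add: normal_moment_def)
  show "normal_moment \<sigma> 3 = 0" using odd[of 1] by (simp add: normal_moment_def)
  show "normal_moment \<sigma> 4 = 3 * \<sigma> ^ 4" using even[of 2]
    by (simp add: normal_moment_def fact_numeral power_divide field_simps power2_eq_square eval_nat_numeral)
qed

text \<open>Completing the square turns the integrand into a multiple of a normal density with
  shifted mean. A nonnegative integral carries no integrability obligation.\<close>

lemma normal_mgf:
  assumes "0 < \<sigma>"
  shows "(\<integral>\<^sup>+x. ennreal (normal_density 0 \<sigma> x) * ennreal (exp (s * x)) \<partial>lborel) = ennreal (exp (s\<^sup>2 * \<sigma>\<^sup>2 / 2))"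
proof -
  have "normal_density 0 \<sigma> x * exp (s * x) = exp (s\<^sup>2 * \<sigma>\<^sup>2 / 2) * normal_density (s * \<sigma>\<^sup>2) \<sigma> x" for x
  proof -
    have "- (x - 0)\<^sup>2 / (2 * \<sigma>\<^sup>2) + s * x = s\<^sup>2 * \<sigma>\<^sup>2 / 2 + - (x - s * \<sigma>\<^sup>2)\<^sup>2 / (2 * \<sigma>\<^sup>2)"
      using assms by (simp add: field_simps power2_eq_square)
    then show ?thesis unfolding normal_density_def by (simp add: exp_add[symmetric])
  qed
  then have "(\<integral>\<^sup>+x. ennreal (normal_density 0 \<sigma> x) * ennreal (exp (s * x)) \<partial>lborel)
      = (\<integral>\<^sup>+x. ennreal (exp (s\<^sup>2 * \<sigma>\<^sup>2 / 2)) * ennreal (normal_density (s * \<sigma>\<^sup>2) \<sigma> x) \<partial>lborel)"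
    by (simp flip: ennreal_mult add: normal_density_nonneg)
  also have "\<dots> = ennreal (exp (s\<^sup>2 * \<sigma>\<^sup>2 / 2)) * (\<integral>\<^sup>+x. ennreal (normal_density (s * \<sigma>\<^sup>2) \<sigma> x) \<partial>lborel)"
    by (rule nn_integral_cmult) simp
  also have "(\<integral>\<^sup>+x. ennreal (normal_density (s * \<sigma>\<^sup>2) \<sigma> x) \<partial>lborel) = 1"
    using assms by (subst nn_integral_eq_integral) (auto simp: normal_density_nonneg)
  finally show ?thesis by simp
qed

text \<open>From \<open>t\<^sup>2 \<le> 2 e\<^sup>t\<close> at \<open>t = L (\<bar>u\<bar> - L)\<close>.\<close>

lemma excess_le_exp:
  assumes "0 < (L :: real)"
  shows "(max (\<bar>u\<bar> - L) 0)\<^sup>2 \<le> 2 / L\<^sup>2 * exp (- L\<^sup>2) * (exp (L * u) + exp (- L * u))"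
proof (cases "\<bar>u\<bar> \<le> L")
  case True
  then show ?thesis by simp
next
  case False
  define t where "t = L * (\<bar>u\<bar> - L)"
  have t: "0 \<le> t" using False assms by (simp add: t_def)
  have "t\<^sup>2 / 2 \<le> exp t" using exp_lower_Taylor_quadratic[OF t] t by linarith
  also have "exp t = exp (- L\<^sup>2) * exp (L * \<bar>u\<bar>)"
    by (simp add: t_def exp_add[symmetric] algebra_simps power2_eq_square)
  also have "\<dots> \<le> exp (- L\<^sup>2) * (exp (L * u) + exp (- L * u))"
    by (intro mult_left_mono) (auto simp: abs_if)
  finally have "L\<^sup>2 * (max (\<bar>u\<bar> - L) 0)\<^sup>2 \<le> 2 * (exp (- L\<^sup>2) * (exp (L * u) + exp (- L * u)))"
    using False by (simp add: t_def power_mult_distrib)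
  then show ?thesis using assms by (simp add: field_simps)
qed

lemma prod_power_of_bool:
  fixes f :: "nat \<Rightarrow> real"
  assumes "i < n"
  shows "(\<Prod>m<n. f m ^ of_bool (m = i)) = f i"
proof -
  have "(\<Prod>m<n. f m ^ of_bool (m = i)) = (\<Prod>m<n. if m = i then f m else 1)"
    by (intro prod.cong) auto
  then show ?thesis using assms by simp
qed

text \<open>Only the noise is random here: designs enter the lemmas of this locale as fixed
  matrices.\<close>

locale gaussian_noise = prob_space M for M :: "'a measure" +
  fixes n :: nat and \<sigma> :: real and \<epsilon> :: "'a \<Rightarrow> real vec"
  assumes \<sigma>: "0 < \<sigma>" and noise: "isotropic_gaussian M n \<sigma> \<epsilon>"
begin

lemma eps_vec: "measurable_vec M n \<epsilon>"
  using noise by (intro measurable_vec_borel_vec) (simp add: isotropic_gaussian_def)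

lemma eps_carrier: "\<omega> \<in> space M \<Longrightarrow> \<epsilon> \<omega> \<in> carrier_vec n"
  by (rule measurable_vecD(1)[OF eps_vec])

lemma eps_measurable: "i < n \<Longrightarrow> (\<lambda>\<omega>. \<epsilon> \<omega> $ i) \<in> borel_measurable M"
  by (rule measurable_vecD(2)[OF eps_vec])

lemma eps_indep: "indep_vars (\<lambda>_. borel) (\<lambda>i \<omega>. \<epsilon> \<omega> $ i) {..<n}"
  and eps_distributed: "i < n \<Longrightarrow> distributed M lborel (\<lambda>\<omega>. \<epsilon> \<omega> $ i) (normal_density 0 \<sigma>)"
  using noise by (auto simp: isotropic_gaussian_def)

lemma eps_power:
  assumes "i < n"
  shows "integrable M (\<lambda>\<omega>. (\<epsilon> \<omega> $ i) ^ a)" "expectation (\<lambda>\<omega>. (\<epsilon> \<omega> $ i) ^ a) = normal_moment \<sigma> a"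
proof -
  have "integrable lborel (\<lambda>x. normal_density 0 \<sigma> x * x ^ a)"
    using integrable_normal_moment[OF \<sigma>, of 0 a] by simp
  then show "integrable M (\<lambda>\<omega>. (\<epsilon> \<omega> $ i) ^ a)"
    using distributed_integrable[OF eps_distributed[OF assms], of "\<lambda>x. x ^ a"] by (simp add: normal_density_nonneg)
  show "expectation (\<lambda>\<omega>. (\<epsilon> \<omega> $ i) ^ a) = normal_moment \<sigma> a"
    unfolding normal_moment_def
    by (rule distributed_integral[OF eps_distributed[OF assms], symmetric]) (auto simp: normal_density_nonneg)
qed

lemma eps_monomial:
  shows "integrable M (\<lambda>\<omega>. \<Prod>i<n. (\<epsilon> \<omega> $ i) ^ a i)"
    "expectation (\<lambda>\<omega>. \<Prod>i<n. (\<epsilon> \<omega> $ i) ^ a i) = (\<Prod>i<n. normal_moment \<sigma> (a i))"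
proof -
  have ind: "indep_vars (\<lambda>_. borel) (\<lambda>i \<omega>. (\<epsilon> \<omega> $ i) ^ a i) {..<n}"
    by (rule indep_vars_compose2[OF eps_indep, where Y = "\<lambda>i x. x ^ a i"]) simp
  show "integrable M (\<lambda>\<omega>. \<Prod>i<n. (\<epsilon> \<omega> $ i) ^ a i)"
    by (rule indep_vars_integrable[OF _ ind]) (auto simp: eps_power)
  show "expectation (\<lambda>\<omega>. \<Prod>i<n. (\<epsilon> \<omega> $ i) ^ a i) = (\<Prod>i<n. normal_moment \<sigma> (a i))"
    by (subst indep_vars_lebesgue_integral[OF _ ind]) (auto simp: eps_power)
qed

text \<open>Isserlis' formula: the fourth moment is a sum over the three pairings of the four
  indices.\<close>

lemma eps_fourth_moment:
  assumes "i < n" "j < n" "k < n" "l < n"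
  shows "integrable M (\<lambda>\<omega>. \<epsilon> \<omega> $ i * \<epsilon> \<omega> $ j * \<epsilon> \<omega> $ k * \<epsilon> \<omega> $ l)"
    and "expectation (\<lambda>\<omega>. \<epsilon> \<omega> $ i * \<epsilon> \<omega> $ j * \<epsilon> \<omega> $ k * \<epsilon> \<omega> $ l)
      = \<sigma> ^ 4 * (of_bool (i = j) * of_bool (k = l) + of_bool (i = k) * of_bool (j = l) + of_bool (i = l) * of_bool (j = k))"
proof -
  \<comment> \<open>Multiplicity of \<open>m\<close> among the four indices; the product becomes a
    monomial in independent coordinates.\<close>
  define c :: "nat \<Rightarrow> nat" where
    "c m = of_bool (m = i) + of_bool (m = j) + of_bool (m = k) + of_bool (m = l)" for m
  have eq: "\<epsilon> \<omega> $ i * \<epsilon> \<omega> $ j * \<epsilon> \<omega> $ k * \<epsilon> \<omega> $ l = (\<Prod>m<n. (\<epsilon> \<omega> $ m) ^ c m)" for \<omega>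
    using assms by (simp add: c_def power_add prod.distrib prod_power_of_bool)
  show "integrable M (\<lambda>\<omega>. \<epsilon> \<omega> $ i * \<epsilon> \<omega> $ j * \<epsilon> \<omega> $ k * \<epsilon> \<omega> $ l)"
    unfolding eq by (rule eps_monomial)
  have m2: "normal_moment \<sigma> (Suc (Suc 0)) = \<sigma>\<^sup>2"
    and m4: "normal_moment \<sigma> (Suc (Suc (Suc (Suc 0)))) = 3 * \<sigma> ^ 4"
    and m3: "normal_moment \<sigma> (Suc (Suc (Suc 0))) = 0"
    using normal_moment_values(3,4,5)[OF \<sigma>] by (simp_all add: eval_nat_numeral)
  have "(\<Prod>m<n. normal_moment \<sigma> (c m)) = (\<Prod>m\<in>{i, j, k, l}. normal_moment \<sigma> (c m))"
    using assms by (intro prod.mono_neutral_right) (auto simp: c_def normal_moment_values[OF \<sigma>])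
  also have "\<dots> = \<sigma> ^ 4 * (of_bool (i = j) * of_bool (k = l) + of_bool (i = k) * of_bool (j = l) + of_bool (i = l) * of_bool (j = k))"
    \<comment> \<open>One case per pattern of coincidences: an index of odd multiplicity contributes
      the factor 0, two distinct pairs give \<open>\<sigma> ^ 4\<close>, and four equal indices give
      \<open>3 * \<sigma> ^ 4\<close>.\<close>
    by (cases "i = j"; cases "i = k"; cases "i = l"; cases "j = k"; cases "j = l"; cases "k = l")
      (simp_all add: c_def normal_moment_values[OF \<sigma>] m2 m3 m4 insert_absorb flip: power_add)
  finally show "expectation (\<lambda>\<omega>. \<epsilon> \<omega> $ i * \<epsilon> \<omega> $ j * \<epsilon> \<omega> $ k * \<epsilon> \<omega> $ l)
      = \<sigma> ^ 4 * (of_bool (i = j) * of_bool (k = l) + of_bool (i = k) * of_bool (j = l) + of_bool (i = l) * of_bool (j = k))"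
    unfolding eq eps_monomial(2) .
qed

lemma eps_second_moment:
  assumes "i < n" "j < n"
  shows "integrable M (\<lambda>\<omega>. \<epsilon> \<omega> $ i * \<epsilon> \<omega> $ j)"
    and "expectation (\<lambda>\<omega>. \<epsilon> \<omega> $ i * \<epsilon> \<omega> $ j) = \<sigma>\<^sup>2 * of_bool (i = j)"
proof -
  define c :: "nat \<Rightarrow> nat" where "c m = of_bool (m = i) + of_bool (m = j)" for m
  have eq: "\<epsilon> \<omega> $ i * \<epsilon> \<omega> $ j = (\<Prod>m<n. (\<epsilon> \<omega> $ m) ^ c m)" for \<omega>
    using assms by (simp add: c_def power_add prod.distrib prod_power_of_bool)
  show "integrable M (\<lambda>\<omega>. \<epsilon> \<omega> $ i * \<epsilon> \<omega> $ j)"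
    unfolding eq by (rule eps_monomial)
  have "(\<Prod>m<n. normal_moment \<sigma> (c m)) = (\<Prod>m\<in>{i, j}. normal_moment \<sigma> (c m))"
    using assms by (intro prod.mono_neutral_right) (auto simp: c_def normal_moment_values[OF \<sigma>])
  also have "\<dots> = \<sigma>\<^sup>2 * of_bool (i = j)"
    using normal_moment_values(3)[OF \<sigma>]
    by (cases "i = j") (simp_all add: c_def normal_moment_values[OF \<sigma>] eval_nat_numeral)
  finally show "expectation (\<lambda>\<omega>. \<epsilon> \<omega> $ i * \<epsilon> \<omega> $ j) = \<sigma>\<^sup>2 * of_bool (i = j)"
    unfolding eq eps_monomial(2) .
qed

lemma eps_linear_mgf:
  "(\<integral>\<^sup>+\<omega>. ennreal (exp (\<Sum>i<n. w i * \<epsilon> \<omega> $ i)) \<partial>M) = ennreal (exp (\<sigma>\<^sup>2 * (\<Sum>i<n. (w i)\<^sup>2) / 2))"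
proof -
  have ind: "indep_vars (\<lambda>_. borel) (\<lambda>i \<omega>. ennreal (exp (w i * \<epsilon> \<omega> $ i))) {..<n}"
    by (rule indep_vars_compose2[OF eps_indep, where Y = "\<lambda>i x. ennreal (exp (w i * x))"]) simp
  have "(\<integral>\<^sup>+\<omega>. ennreal (exp (\<Sum>i<n. w i * \<epsilon> \<omega> $ i)) \<partial>M) = (\<integral>\<^sup>+\<omega>. (\<Prod>i<n. ennreal (exp (w i * \<epsilon> \<omega> $ i))) \<partial>M)"
    by (simp add: exp_sum prod_ennreal)
  also have "\<dots> = (\<Prod>i<n. \<integral>\<^sup>+\<omega>. ennreal (exp (w i * \<epsilon> \<omega> $ i)) \<partial>M)"
    by (rule indep_vars_nn_integral[OF _ ind]) auto
  also have "\<dots> = (\<Prod>i<n. ennreal (exp ((w i)\<^sup>2 * \<sigma>\<^sup>2 / 2)))"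
  proof (intro prod.cong refl)
    fix i assume "i \<in> {..<n}"
    then have "(\<integral>\<^sup>+\<omega>. ennreal (exp (w i * \<epsilon> \<omega> $ i)) \<partial>M)
        = (\<integral>\<^sup>+x. ennreal (normal_density 0 \<sigma> x) * ennreal (exp (w i * x)) \<partial>lborel)"
      by (intro distributed_nn_integral[OF eps_distributed, symmetric]) auto
    then show "(\<integral>\<^sup>+\<omega>. ennreal (exp (w i * \<epsilon> \<omega> $ i)) \<partial>M) = ennreal (exp ((w i)\<^sup>2 * \<sigma>\<^sup>2 / 2))"
      by (simp add: normal_mgf[OF \<sigma>])
  qed
  also have "\<dots> = ennreal (exp (\<sigma>\<^sup>2 * (\<Sum>i<n. (w i)\<^sup>2) / 2))"
    by (simp add: prod_ennreal exp_sum[symmetric] sum_distrib_left sum_divide_distrib mult.commute)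
  finally show ?thesis .
qed

text \<open>Integrate \<open>excess_le_exp\<close>. The linear form has variance at most 1, so each
  exponential has mean at most \<open>exp (L\<^sup>2 / 2)\<close>, and half of the exponent in
  \<open>exp (- L\<^sup>2)\<close> survives.\<close>

lemma excess_moment:
  assumes "0 < L" and w: "\<sigma>\<^sup>2 * (\<Sum>i<n. (w i)\<^sup>2) \<le> 1"
  shows "(\<integral>\<^sup>+\<omega>. ennreal ((max (\<bar>\<Sum>i<n. w i * \<epsilon> \<omega> $ i\<bar> - L) 0)\<^sup>2) \<partial>M) \<le> ennreal (4 / L\<^sup>2 * exp (- L\<^sup>2 / 2))"
proof -
  define u where "u \<omega> = (\<Sum>i<n. w i * \<epsilon> \<omega> $ i)" for \<omega>
  define C where "C = 2 / L\<^sup>2 * exp (- L\<^sup>2)"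
  have C: "0 \<le> C" by (simp add: C_def)
  have [measurable]: "u \<in> borel_measurable M"
    unfolding u_def using eps_measurable by (intro borel_measurable_sum borel_measurable_times borel_measurable_const) auto
  have mgf: "(\<integral>\<^sup>+\<omega>. ennreal (exp (s * u \<omega>)) \<partial>M) \<le> ennreal (exp (L\<^sup>2 / 2))" if s: "s\<^sup>2 = L\<^sup>2" for s
  proof -
    have "(\<integral>\<^sup>+\<omega>. ennreal (exp (s * u \<omega>)) \<partial>M) = ennreal (exp (\<sigma>\<^sup>2 * (\<Sum>i<n. (s * w i)\<^sup>2) / 2))"
      using eps_linear_mgf[of "\<lambda>i. s * w i"] by (simp add: u_def sum_distrib_left mult.assoc)
    also have "\<sigma>\<^sup>2 * (\<Sum>i<n. (s * w i)\<^sup>2) = L\<^sup>2 * (\<sigma>\<^sup>2 * (\<Sum>i<n. (w i)\<^sup>2))"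
      by (simp add: power_mult_distrib s sum_distrib_left mult.left_commute)
    also have "ennreal (exp (L\<^sup>2 * (\<sigma>\<^sup>2 * (\<Sum>i<n. (w i)\<^sup>2)) / 2)) \<le> ennreal (exp (L\<^sup>2 / 2))"
      using w by (intro ennreal_leI) (simp add: mult_left_le)
    finally show ?thesis .
  qed
  have "(\<integral>\<^sup>+\<omega>. ennreal ((max (\<bar>u \<omega>\<bar> - L) 0)\<^sup>2) \<partial>M)
      \<le> (\<integral>\<^sup>+\<omega>. ennreal C * (ennreal (exp (L * u \<omega>)) + ennreal (exp (- L * u \<omega>))) \<partial>M)"
    using excess_le_exp[OF \<open>0 < L\<close>] C
    by (intro nn_integral_mono) (simp add: C_def flip: ennreal_plus ennreal_mult)
  also have "\<dots> = ennreal C * ((\<integral>\<^sup>+\<omega>. ennreal (exp (L * u \<omega>)) \<partial>M) + (\<integral>\<^sup>+\<omega>. ennreal (exp (- L * u \<omega>)) \<partial>M))"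
    by (subst nn_integral_cmult, simp, subst nn_integral_add) simp_all
  also have "\<dots> \<le> ennreal C * (ennreal (exp (L\<^sup>2 / 2)) + ennreal (exp (L\<^sup>2 / 2)))"
    using mgf[of L] mgf[of "- L"] by (intro mult_left_mono add_mono) auto
  also have "\<dots> = ennreal (C * (2 * exp (L\<^sup>2 / 2)))"
    using C by (simp flip: ennreal_plus ennreal_mult)
  also have "C * (2 * exp (L\<^sup>2 / 2)) = 4 / L\<^sup>2 * exp (- L\<^sup>2 / 2)"
    by (simp add: C_def exp_add[symmetric])
  finally show ?thesis by (simp add: u_def)
qed

text \<open>Chebyshev, with the variance \<open>2 \<sigma>\<^sup>4 k\<close> of the quadratic form \<open>\<parallel>P \<epsilon>\<parallel>\<^sup>2\<close>.\<close>

lemma proj_tail: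
  assumes "regular_design X n p T" and t: "0 < t" and k: "1 \<le> card T"
  shows "prob {\<omega> \<in> space M. \<sigma> * sqrt (card T) + t < norm2 (proj_mat X T *\<^sub>v \<epsilon> \<omega>)} \<le> \<sigma>\<^sup>2 / (2 * t\<^sup>2)"
proof -
  interpret D: regular_design X n p T by fact
  let ?P = "proj_mat X T" and ?k = "card T"
  define q where "q i j = ?P $$ (i, j)" for i j
  define Q where "Q \<omega> = (\<Sum>i<n. \<Sum>j<n. q i j * (\<epsilon> \<omega> $ i * \<epsilon> \<omega> $ j))" for \<omega>
  have Q: "(norm2 (?P *\<^sub>v \<epsilon> \<omega>))\<^sup>2 = Q \<omega>" if "\<omega> \<in> space M" for \<omega>
    using eps_carrier[OF that] D.P_carrier unfolding D.norm2_P_power2[OF eps_carrier[OF that]]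
    by (simp add: scalar_prod_def lessThan_atLeast0 Q_def q_def sum_distrib_left mult.assoc mult.left_commute)
  have q_sym: "q i j = q j i" if "i < n" "j < n" for i j
    using arg_cong[OF D.P_sym, of "\<lambda>A. A $$ (i, j)"] that D.P_carrier by (simp add: q_def)
  have [measurable]: "Q \<in> borel_measurable M"
    unfolding Q_def using eps_measurable
    by (intro borel_measurable_sum borel_measurable_times borel_measurable_const) auto
  have Q2: "(Q \<omega>)\<^sup>2 = (\<Sum>i<n. \<Sum>j<n. \<Sum>k<n. \<Sum>l<n.
      q i j * q k l * (\<epsilon> \<omega> $ i * \<epsilon> \<omega> $ j * \<epsilon> \<omega> $ k * \<epsilon> \<omega> $ l))" for \<omega>
    unfolding power2_eq_square Q_def sum_distrib_left sum_distrib_right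
    by (intro sum.cong refl) (simp add: mult_ac)
  have intQ: "expectation Q = \<sigma>\<^sup>2 * ?k"
  proof -
    have "expectation Q = (\<Sum>i<n. \<Sum>j<n. q i j * (\<sigma>\<^sup>2 * of_bool (i = j)))"
      unfolding Q_def
      by (intro has_bochner_integral_integral_eq has_bochner_integral_sum has_bochner_integral_mult_right)
        (simp add: has_bochner_integral_iff eps_second_moment)
    also have "\<dots> = (\<Sum>i<n. \<sigma>\<^sup>2 * q i i)"
      by (intro sum.cong refl) (simp add: of_bool_def if_distrib[of "\<lambda>z. _ * z"] mult.commute cong: if_cong)
    finally show ?thesis using D.P_trace by (simp add: q_def flip: sum_distrib_left)
  qed
  have integrable_Q2: "integrable M (\<lambda>\<omega>. (Q \<omega>)\<^sup>2)"
    unfolding Q2 by (intro Bochner_Integration.integrable_sum integrable_mult_right eps_fourth_moment(1)) auto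
  have intQ2: "expectation (\<lambda>\<omega>. (Q \<omega>)\<^sup>2) = \<sigma> ^ 4 * (?k\<^sup>2 + 2 * ?k)"
  proof -
    have "expectation (\<lambda>\<omega>. (Q \<omega>)\<^sup>2) = (\<Sum>i<n. \<Sum>j<n. \<Sum>k<n. \<Sum>l<n. q i j * q k l *
        (\<sigma> ^ 4 * (of_bool (i = j) * of_bool (k = l) + of_bool (i = k) * of_bool (j = l) + of_bool (i = l) * of_bool (j = k))))"
      unfolding Q2
      by (intro has_bochner_integral_integral_eq has_bochner_integral_sum has_bochner_integral_mult_right)
        (simp add: has_bochner_integral_iff eps_fourth_moment)
    \<comment> \<open>The first pairing yields the squared trace of \<open>P\<close>, each of the
      other two the sum of its squared entries; in total \<open>?k\<^sup>2 + 2 * ?k\<close>.\<close>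
    also have "\<dots> = \<sigma> ^ 4 * ((\<Sum>i<n. \<Sum>j<n. \<Sum>k<n. \<Sum>l<n. q i j * q k l * (of_bool (i = j) * of_bool (k = l)))
        + (\<Sum>i<n. \<Sum>j<n. \<Sum>k<n. \<Sum>l<n. q i j * q k l * (of_bool (i = k) * of_bool (j = l)))
        + (\<Sum>i<n. \<Sum>j<n. \<Sum>k<n. \<Sum>l<n. q i j * q k l * (of_bool (i = l) * of_bool (j = k))))"
      by (simp add: sum_distrib_left sum.distrib[symmetric] algebra_simps)
    also have "(\<Sum>i<n. \<Sum>j<n. \<Sum>k<n. \<Sum>l<n. q i j * q k l * (of_bool (i = j) * of_bool (k = l)))
        = (\<Sum>i<n. \<Sum>j<n. q i j * of_bool (i = j)) * (\<Sum>k<n. \<Sum>l<n. q k l * of_bool (k = l))"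
      unfolding sum_distrib_left sum_distrib_right by (intro sum.cong refl) (simp add: mult_ac)
    also have "(\<Sum>i<n. \<Sum>j<n. q i j * of_bool (i = j)) = (\<Sum>i<n. q i i)"
      by (intro sum.cong refl) (simp add: of_bool_def if_distrib[of "\<lambda>z. _ * z"] cong: if_cong)
    also have "(\<Sum>i<n. \<Sum>j<n. \<Sum>k<n. \<Sum>l<n. q i j * q k l * (of_bool (i = k) * of_bool (j = l)))
        = (\<Sum>i<n. \<Sum>j<n. (q i j)\<^sup>2)"
      by (intro sum.cong refl) (simp add: of_bool_def if_distrib[of "\<lambda>z. _ * z"] if_distrib[of "\<lambda>z. z * _"] power2_eq_square cong: if_cong)
    also have "(\<Sum>i<n. \<Sum>j<n. \<Sum>k<n. \<Sum>l<n. q i j * q k l * (of_bool (i = l) * of_bool (j = k)))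
        = (\<Sum>i<n. \<Sum>j<n. (q i j)\<^sup>2)"
      by (intro sum.cong refl, subst sum.swap)
        (simp add: of_bool_def if_distrib[of "\<lambda>z. _ * z"] if_distrib[of "\<lambda>z. z * _"] power2_eq_square q_sym cong: if_cong)
    finally show ?thesis using D.P_trace D.P_sq_sum by (simp add: q_def power2_eq_square)
  qed
  have integrable_Q: "integrable M Q"
    using integrable_Q2 by (rule square_integrable_imp_integrable[rotated]) simp
  have "variance Q = 2 * \<sigma> ^ 4 * ?k"
    unfolding variance_eq[OF integrable_Q integrable_Q2] intQ2 unfolding intQ
    by (simp add: power_mult_distrib algebra_simps flip: power_mult)
  \<comment> \<open>The cross term in the square of \<open>\<sigma> * sqrt ?k + t\<close>: exceeding
    that threshold moves \<open>Q\<close> away from its mean by at least \<open>a\<close>.\<close>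
  moreover define a where "a = 2 * \<sigma> * sqrt ?k * t"
  moreover have a: "0 < a" using \<sigma> t k by (simp add: a_def)
  ultimately have cheb: "prob {\<omega> \<in> space M. a \<le> \<bar>Q \<omega> - \<sigma>\<^sup>2 * ?k\<bar>} \<le> 2 * \<sigma> ^ 4 * ?k / a\<^sup>2"
    using Chebyshev_inequality[OF _ integrable_Q2 a] by (simp add: intQ)
  have "a \<le> \<bar>Q \<omega> - \<sigma>\<^sup>2 * ?k\<bar>"
    if w: "\<omega> \<in> space M" and less: "\<sigma> * sqrt ?k + t < norm2 (?P *\<^sub>v \<epsilon> \<omega>)" for \<omega>
  proof -
    have "0 \<le> \<sigma> * sqrt ?k + t" using \<sigma> t by simp
    then have "(\<sigma> * sqrt ?k + t)\<^sup>2 \<le> (norm2 (?P *\<^sub>v \<epsilon> \<omega>))\<^sup>2" using less by (intro power_mono) auto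
    moreover have "(\<sigma> * sqrt ?k + t)\<^sup>2 = \<sigma>\<^sup>2 * ?k + a + t\<^sup>2"
      by (simp add: power2_sum power_mult_distrib a_def)
    moreover have "0 \<le> t\<^sup>2" by simp
    ultimately show ?thesis unfolding Q[OF w] by linarith
  qed
  then have "prob {\<omega> \<in> space M. \<sigma> * sqrt ?k + t < norm2 (?P *\<^sub>v \<epsilon> \<omega>)} \<le> prob {\<omega> \<in> space M. a \<le> \<bar>Q \<omega> - \<sigma>\<^sup>2 * ?k\<bar>}"
    by (intro finite_measure_mono) auto
  also have "\<dots> \<le> 2 * \<sigma> ^ 4 * ?k / a\<^sup>2" by (rule cheb)
  also have "\<dots> = \<sigma>\<^sup>2 / (2 * t\<^sup>2)"
    using \<sigma> t k by (simp add: a_def power_mult_distrib field_simps flip: power_add)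
  finally show ?thesis .
qed

text \<open>The normalized variable is a linear form in the noise, with weights taken from the
  projected column. Contraction and the column bound make its variance at most 1.\<close>

lemma g_tilde_excess_moment:
  assumes "regular_design X n p T" and j: "j < p" and norm: "norm2 (X *\<^sub>v unit_vec p j) \<le> sqrt n" and L: "0 < L"
  shows "(\<integral>\<^sup>+\<omega>. ennreal ((max (\<bar>g_tilde X T (\<epsilon> \<omega>) j\<bar> / \<sigma> - L) 0)\<^sup>2) \<partial>M) \<le> ennreal (4 / L\<^sup>2 * exp (- L\<^sup>2 / 2))"
proof -
  interpret D: regular_design X n p T by fact
  define c where "c = X *\<^sub>v unit_vec p j"
  have c: "c \<in> carrier_vec n" using D.X by (simp add: c_def)
  define v where "v = c - proj_mat X T *\<^sub>v c"
  have v: "v \<in> carrier_vec n" using c D.P_mult_carrier[OF c] by (simp add: v_def)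
  define w where "w i = v $ i / (\<sigma> * sqrt n)" for i
  have g: "\<bar>g_tilde X T (\<epsilon> \<omega>) j\<bar> / \<sigma> = \<bar>\<Sum>i<n. w i * \<epsilon> \<omega> $ i\<bar>" if "\<omega> \<in> space M" for \<omega>
  proof -
    have "g_tilde X T (\<epsilon> \<omega>) j = (\<epsilon> \<omega> \<bullet> v) / sqrt n"
      using D.X D.compl_P_mult[OF c] by (simp add: g_tilde_def v_def c_def)
    also have "\<epsilon> \<omega> \<bullet> v = (\<Sum>i<n. v $ i * \<epsilon> \<omega> $ i)"
      using v by (simp add: scalar_prod_def lessThan_atLeast0 mult.commute)
    finally have "g_tilde X T (\<epsilon> \<omega>) j / \<sigma> = (\<Sum>i<n. w i * \<epsilon> \<omega> $ i)"
      by (simp add: w_def sum_divide_distrib mult.commute)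
    then show ?thesis using \<sigma> by (metis abs_divide abs_of_pos)
  qed
  have "\<sigma>\<^sup>2 * (\<Sum>i<n. (w i)\<^sup>2) \<le> 1"
  proof -
    have "(norm2 v)\<^sup>2 \<le> (norm2 c)\<^sup>2" using D.norm2_compl_P[OF c] by (simp add: v_def)
    also have "\<dots> \<le> (sqrt n)\<^sup>2" using norm by (intro power_mono) (auto simp: c_def norm2_nonneg)
    finally have "(norm2 v)\<^sup>2 \<le> n" by simp
    moreover have "(norm2 v)\<^sup>2 = (\<Sum>i<n. (v $ i)\<^sup>2)" using v by (simp add: norm2_def sum_nonneg)
    moreover have "\<sigma>\<^sup>2 * (\<Sum>i<n. (w i)\<^sup>2) = (\<Sum>i<n. (v $ i)\<^sup>2) / n"
      using \<sigma> by (simp add: w_def power_divide power_mult_distrib sum_distrib_left sum_divide_distrib)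
    ultimately show ?thesis by (simp add: divide_le_eq)
  qed
  from excess_moment[OF L this] show ?thesis
    by (subst nn_integral_cong[where v = "\<lambda>\<omega>. ennreal ((max (\<bar>\<Sum>i<n. w i * \<epsilon> \<omega> $ i\<bar> - L) 0)\<^sup>2)"])
      (simp_all add: g)
qed

text \<open>Markov for the thresholded sum gives the term \<open>4 / x\<^sup>2\<close>, the tail of
  the projected noise gives 50. The bound involves the design only through \<open>p\<close> and the
  size of \<open>T\<close>.\<close>

lemma Omega_cond_fixed_design:
  assumes D: "regular_design X n p T" and k: "1 \<le> card T" and pos: "0 < \<xi>" "0 < x"
    and norm: "\<And>j. j < p \<Longrightarrow> norm2 (X *\<^sub>v unit_vec p j) \<le> sqrt n"
  shows "prob {\<omega> \<in> space M. \<not> Omega_cond \<xi> x \<sigma> T X (\<epsilon> \<omega>)}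
    \<le> (4 / x\<^sup>2 + 50) / (2 * ln (exp 1 * real p / real (card T)))"
proof -
  interpret D: regular_design X n p T by fact
  let ?k = "card T"
  define L where "L = sqrt (2 * ln (exp 1 * real p / real ?k))"
  have kp: "?k \<le> p" using card_mono[OF _ D.T] by simp
  have "1 \<le> ln (exp 1 * real p / real ?k)" using k kp by (rule ln_ratio_ge_1)
  then have L: "0 < L" and L2: "L\<^sup>2 = 2 * ln (exp 1 * real p / real ?k)" by (auto simp: L_def)
  have dimX: "dim_row X = n" "dim_col X = p" using D.X by auto
  define f where "f j \<omega> = (max (\<bar>g_tilde X T (\<epsilon> \<omega>) j\<bar> / \<sigma> - L) 0)\<^sup>2" for j \<omega>
  define S where "S \<omega> = (\<Sum>j\<in>{..<p} - T. f j \<omega>)" for \<omega>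
  define t where "t = 1 / 10 * lasso_lambda \<xi> \<sigma> p ?k"
  have t_eq: "t = (1 + \<xi>) * \<sigma> * L / 10" by (simp add: t_def lasso_lambda_def L_def)
  have t: "0 < t" using \<sigma> L pos by (simp add: t_eq)
  have P: "proj_mat X T \<in> carrier_mat n n" by (rule D.P_carrier)
  have [measurable]: "f j \<in> borel_measurable M" for j
  proof -
    have "(\<lambda>\<omega>. g_tilde X T (\<epsilon> \<omega>) j) \<in> borel_measurable M"
      unfolding g_tilde_def dimX using P D.X
      by (intro borel_measurable_divide borel_measurable_const borel_measurable_scalar_prod[OF eps_vec]
          measurable_vec_const) (auto intro!: mult_mat_vec_carrier minus_carrier_mat)
    then show ?thesis unfolding f_def by measurable
  qed
  have [measurable]: "S \<in> borel_measurable M" unfolding S_def by measurable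
  have [measurable]: "(\<lambda>\<omega>. norm2 (proj_mat X T *\<^sub>v \<epsilon> \<omega>)) \<in> borel_measurable M"
    by (rule borel_measurable_norm2[OF measurable_vec_mult[OF measurable_mat_const[OF P] eps_vec]])
  have f_nonneg: "0 \<le> f j \<omega>" for j \<omega> by (simp add: f_def)
  then have S_nonneg: "0 \<le> S \<omega>" for \<omega> by (simp add: S_def sum_nonneg)

  have "(\<integral>\<^sup>+\<omega>. ennreal (S \<omega>) \<partial>M) = (\<Sum>j\<in>{..<p} - T. \<integral>\<^sup>+\<omega>. ennreal (f j \<omega>) \<partial>M)"
    unfolding S_def using f_nonneg by (subst nn_integral_sum[symmetric]) (simp_all flip: sum_ennreal)
  also have "\<dots> \<le> (\<Sum>j\<in>{..<p} - T. ennreal (4 / L\<^sup>2 * exp (- L\<^sup>2 / 2)))"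
    unfolding f_def by (intro sum_mono g_tilde_excess_moment[OF D _ norm L]) auto
  also have "\<dots> = ennreal (real (card ({..<p} - T)) * (4 / L\<^sup>2 * exp (- L\<^sup>2 / 2)))"
    by (subst ennreal_mult) (simp_all add: ennreal_of_nat_eq_real_of_nat)
  also have "\<dots> \<le> ennreal (real p * (4 / L\<^sup>2 * exp (- L\<^sup>2 / 2)))"
    using card_mono[of "{..<p}" "{..<p} - T"] by (intro ennreal_leI mult_right_mono) auto
  \<comment> \<open>By the choice of \<open>L\<close> each expected excess is proportional to k / p,
    so the sum of at most p of them is of order \<open>k / L\<^sup>2\<close>.\<close>
  also have "exp (- L\<^sup>2 / 2) = real ?k / (exp 1 * real p)"
    using k kp by (simp add: L2 exp_minus)
  also have "real p * (4 / L\<^sup>2 * (real ?k / (exp 1 * real p))) = 4 / L\<^sup>2 * real ?k / exp 1"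
    using k kp by simp
  also have "ennreal (4 / L\<^sup>2 * real ?k / exp 1) \<le> ennreal (4 / L\<^sup>2 * real ?k)"
    using divide_left_mono[of 1 "exp 1" "4 / L\<^sup>2 * real ?k"] by (intro ennreal_leI) simp
  finally have ES: "(\<integral>\<^sup>+\<omega>. ennreal (S \<omega>) \<partial>M) \<le> ennreal (4 / L\<^sup>2 * real ?k)" .

  have kx: "0 < real ?k * x\<^sup>2" using k pos by simp
  have "emeasure M {\<omega> \<in> space M. real ?k * x\<^sup>2 < S \<omega>}
      \<le> emeasure M {\<omega> \<in> space M. 1 \<le> ennreal (1 / (real ?k * x\<^sup>2)) * ennreal (S \<omega>)}"
    using kx S_nonneg
    by (intro emeasure_mono) (auto simp: pos_le_divide_eq simp flip: ennreal_mult ennreal_1)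
  also have "\<dots> \<le> ennreal (1 / (real ?k * x\<^sup>2)) * (\<integral>\<^sup>+\<omega>. ennreal (S \<omega>) * indicator (space M) \<omega> \<partial>M)"
    by (rule nn_integral_Markov_inequality) auto
  also have "(\<integral>\<^sup>+\<omega>. ennreal (S \<omega>) * indicator (space M) \<omega> \<partial>M) = (\<integral>\<^sup>+\<omega>. ennreal (S \<omega>) \<partial>M)"
    by (intro nn_integral_cong) simp
  also have "ennreal (1 / (real ?k * x\<^sup>2)) * \<dots> \<le> ennreal (1 / (real ?k * x\<^sup>2)) * ennreal (4 / L\<^sup>2 * real ?k)"
    using ES by (intro mult_left_mono) auto
  also have "\<dots> = ennreal (4 / x\<^sup>2 / L\<^sup>2)"
    using k by (subst ennreal_mult[symmetric]) (auto simp: field_simps)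
  finally have 1: "prob {\<omega> \<in> space M. real ?k * x\<^sup>2 < S \<omega>} \<le> 4 / x\<^sup>2 / L\<^sup>2"
    by (simp add: emeasure_eq_measure)

  have "prob {\<omega> \<in> space M. \<sigma> * sqrt ?k + t < norm2 (proj_mat X T *\<^sub>v \<epsilon> \<omega>)} \<le> \<sigma>\<^sup>2 / (2 * t\<^sup>2)"
    by (rule proj_tail[OF D t k])
  \<comment> \<open>50 is 100 / 2: the factor 1/10 in \<open>t\<close> enters squared, and the 2
    comes from the tail bound.\<close>
  also have "\<dots> \<le> 50 / L\<^sup>2"
  proof -
    have t2: "t\<^sup>2 = (1 + \<xi>)\<^sup>2 * L\<^sup>2 * \<sigma>\<^sup>2 / 100"
      unfolding t_eq power_divide power_mult_distrib by simp
    have "\<sigma>\<^sup>2 / (2 * t\<^sup>2) = 50 / ((1 + \<xi>)\<^sup>2 * L\<^sup>2)" unfolding t2 using \<sigma> by simp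
    also have "\<dots> \<le> 50 / L\<^sup>2"
    proof (rule divide_left_mono)
      show "L\<^sup>2 \<le> (1 + \<xi>)\<^sup>2 * L\<^sup>2"
        using mult_right_mono[of 1 "(1 + \<xi>)\<^sup>2" "L\<^sup>2"] pos by simp
    qed (use L pos in auto)
    finally show ?thesis .
  qed
  finally have 2: "prob {\<omega> \<in> space M. \<sigma> * sqrt ?k + t < norm2 (proj_mat X T *\<^sub>v \<epsilon> \<omega>)} \<le> 50 / L\<^sup>2" .

  have "{\<omega> \<in> space M. \<not> Omega_cond \<xi> x \<sigma> T X (\<epsilon> \<omega>)} = {\<omega> \<in> space M. real ?k * x\<^sup>2 < S \<omega>}
      \<union> {\<omega> \<in> space M. \<sigma> * sqrt ?k + t < norm2 (proj_mat X T *\<^sub>v \<epsilon> \<omega>)}"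
    by (auto simp: Omega_cond_def dimX S_def f_def L_def t_def not_le)
  also have "prob \<dots> \<le> prob {\<omega> \<in> space M. real ?k * x\<^sup>2 < S \<omega>}
      + prob {\<omega> \<in> space M. \<sigma> * sqrt ?k + t < norm2 (proj_mat X T *\<^sub>v \<epsilon> \<omega>)}"
    by (intro measure_Un_le) auto
  also have "\<dots> \<le> (4 / x\<^sup>2 + 50) / L\<^sup>2" using 1 2 by (simp add: add_divide_distrib)
  finally show ?thesis by (simp add: L2)
qed

end

section \<open>Random designs\<close>

context prob_space
begin

text \<open>Independence fixes the joint law on measurable rectangles, and these determine a product
  measure.\<close>

lemma indep_rv_distr:
  assumes "indep_rv M S U T V"
  shows "distr M S U \<Otimes>\<^sub>M distr M T V = distr M (S \<Otimes>\<^sub>M T) (\<lambda>\<omega>. (U \<omega>, V \<omega>))"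
proof -
  have U[measurable]: "U \<in> measurable M S" and V[measurable]: "V \<in> measurable M T"
    and ind: "indep_set (sets (vimage_algebra (space M) U S)) (sets (vimage_algebra (space M) V T))"
    using assms by (auto simp: indep_rv_def)
  show ?thesis
  proof (rule pair_measure_eqI)
    show "sigma_finite_measure (distr M S U)" "sigma_finite_measure (distr M T V)"
      using U V by (auto intro!: prob_space_imp_sigma_finite prob_space_distr)
  next
    fix A B assume "A \<in> sets (distr M S U)" "B \<in> sets (distr M T V)"
    then have [measurable]: "A \<in> sets S" "B \<in> sets T" by auto
    have "prob ((U -` A \<inter> space M) \<inter> (V -` B \<inter> space M)) = prob (U -` A \<inter> space M) * prob (V -` B \<inter> space M)"
      by (intro indep_setD[OF ind] in_vimage_algebra) auto
    moreover have "(U -` A \<inter> space M) \<inter> (V -` B \<inter> space M) = (\<lambda>\<omega>. (U \<omega>, V \<omega>)) -` (A \<times> B) \<inter> space M"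
      by auto
    ultimately show "emeasure (distr M S U) A * emeasure (distr M T V) B
        = emeasure (distr M (S \<Otimes>\<^sub>M T) (\<lambda>\<omega>. (U \<omega>, V \<omega>))) (A \<times> B)"
      by (simp add: emeasure_distr emeasure_eq_measure ennreal_mult)
  qed simp
qed

text \<open>Tonelli on the product law: a bound valid for almost every frozen value of
  \<open>U\<close> passes to the joint event.\<close>

lemma indep_rv_prob_le:
  assumes ind: "indep_rv M S U T V"
    and Q: "Measurable.pred (S \<Otimes>\<^sub>M T) (\<lambda>z. Q (fst z) (snd z))"
    and le: "AE \<omega> in M. prob {\<omega>' \<in> space M. Q (U \<omega>) (V \<omega>')} \<le> c"
  shows "prob {\<omega> \<in> space M. Q (U \<omega>) (V \<omega>)} \<le> c"
proof -
  have [measurable]: "U \<in> measurable M S" "V \<in> measurable M T" using ind by (auto simp: indep_rv_def)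
  interpret V: prob_space "distr M T V" by (rule prob_space_distr) simp
  define B where "B = {z \<in> space (S \<Otimes>\<^sub>M T). Q (fst z) (snd z)}"
  have B[measurable]: "B \<in> sets (S \<Otimes>\<^sub>M T)" using Q by (simp only: B_def pred_def)
  \<comment> \<open>A probability space has positive mass, so the almost sure bound holds at some
    outcome and compares \<open>c\<close> with a nonnegative number.\<close>
  have c: "0 \<le> c"
  proof -
    have "AE \<omega> in M. 0 \<le> c" using le by eventually_elim (use measure_nonneg order_trans in blast)
    then show ?thesis by simp
  qed
  have UV: "U \<omega> \<in> space S" "V \<omega> \<in> space T" if "\<omega> \<in> space M" for \<omega>
    using that by (auto intro: measurable_space)
  have "emeasure M {\<omega> \<in> space M. Q (U \<omega>) (V \<omega>)} = emeasure (distr M (S \<Otimes>\<^sub>M T) (\<lambda>\<omega>. (U \<omega>, V \<omega>))) B"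
  proof -
    have "(\<lambda>\<omega>. (U \<omega>, V \<omega>)) -` B \<inter> space M = {\<omega> \<in> space M. Q (U \<omega>) (V \<omega>)}"
      using UV by (auto simp: B_def space_pair_measure)
    then show ?thesis by (simp add: emeasure_distr)
  qed
  also have "\<dots> = emeasure (distr M S U \<Otimes>\<^sub>M distr M T V) B" by (simp add: indep_rv_distr[OF ind])
  also have "\<dots> = (\<integral>\<^sup>+a. emeasure (distr M T V) (Pair a -` B) \<partial>distr M S U)"
    by (rule V.emeasure_pair_measure_alt) simp
  also have "\<dots> = (\<integral>\<^sup>+\<omega>. emeasure (distr M T V) (Pair (U \<omega>) -` B) \<partial>M)"
    by (rule nn_integral_distr) (simp_all add: V.measurable_emeasure_Pair)
  also have "\<dots> \<le> (\<integral>\<^sup>+\<omega>. ennreal c \<partial>M)"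
  proof (rule nn_integral_mono_AE, use le AE_space in eventually_elim)
    case (elim \<omega>)
    have "emeasure (distr M T V) (Pair (U \<omega>) -` B) = emeasure M (V -` (Pair (U \<omega>) -` B) \<inter> space M)"
      by (intro emeasure_distr sets_Pair1[OF B]) simp
    also have "V -` (Pair (U \<omega>) -` B) \<inter> space M = {\<omega>' \<in> space M. Q (U \<omega>) (V \<omega>')}"
      using elim UV by (auto simp: B_def space_pair_measure)
    finally show ?case using elim c by (simp add: emeasure_eq_measure)
  qed
  also have "\<dots> = ennreal c" by (simp add: emeasure_space_1)
  finally show ?thesis using c by (simp add: emeasure_eq_measure)
qed

end

text \<open>The estimate for a frozen design is the same for almost every outcome of
  \<open>X\<close>, so it survives averaging. The explicit rate is uniform in \<open>n\<close>,
  \<open>\<sigma>\<close> and \<open>\<xi>\<close>.\<close>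

lemma Omega_cond_prob:
  assumes "prob_space M" and \<sigma>: "0 < \<sigma>" and pos: "0 < \<xi>" "0 < x"
    and noise: "isotropic_gaussian M n \<sigma> \<epsilon>"
    and ind: "indep_rv M (borel_mat n p) X (borel_vec n) \<epsilon>"
    and T: "T \<subseteq> {..<p}" and k: "1 \<le> card T"
    and inv: "AE \<omega> in M. invertible_mat (gram (X \<omega>) T)"
    and norm: "AE \<omega> in M. \<forall>j<p. norm2 (X \<omega> *\<^sub>v unit_vec p j) \<le> sqrt n"
  shows "1 - (4 / x\<^sup>2 + 50) / (2 * ln (exp 1 * real p / real (card T)))
    \<le> measure M {\<omega> \<in> space M. Omega_cond \<xi> x \<sigma> T (X \<omega>) (\<epsilon> \<omega>)}"
proof -
  interpret prob_space M by fact
  interpret G: gaussian_noise M n \<sigma> \<epsilon> using \<sigma> noise by unfold_locales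
  have X: "measurable_mat M n p X" using ind by (intro measurable_mat_borel_mat) (simp add: indep_rv_def)
  have "Measurable.pred (borel_mat n p \<Otimes>\<^sub>M borel_vec n) (\<lambda>z. Omega_cond \<xi> x \<sigma> T (fst z) (snd z))"
    by (intro pred_Omega_cond[OF _ _ T] measurable_mat_borel_mat measurable_vec_borel_vec) auto
  then have "Measurable.pred (borel_mat n p \<Otimes>\<^sub>M borel_vec n) (\<lambda>z. \<not> Omega_cond \<xi> x \<sigma> T (fst z) (snd z))"
    by (rule pred_intros_logic)
  moreover have "AE \<omega> in M. prob {\<omega>' \<in> space M. \<not> Omega_cond \<xi> x \<sigma> T (X \<omega>) (\<epsilon> \<omega>')}
      \<le> (4 / x\<^sup>2 + 50) / (2 * ln (exp 1 * real p / real (card T)))"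
    using inv norm AE_space
  proof eventually_elim
    case (elim \<omega>)
    then have "regular_design (X \<omega>) n p T"
      using T measurable_matD(1)[OF X] by unfold_locales auto
    then show ?case using k pos elim by (intro G.Omega_cond_fixed_design) auto
  qed
  ultimately have "prob {\<omega> \<in> space M. \<not> Omega_cond \<xi> x \<sigma> T (X \<omega>) (\<epsilon> \<omega>)}
      \<le> (4 / x\<^sup>2 + 50) / (2 * ln (exp 1 * real p / real (card T)))"
    by (rule indep_rv_prob_le[OF ind])
  moreover have "prob {\<omega> \<in> space M. \<not> Omega_cond \<xi> x \<sigma> T (X \<omega>) (\<epsilon> \<omega>)}
      = 1 - prob {\<omega> \<in> space M. Omega_cond \<xi> x \<sigma> T (X \<omega>) (\<epsilon> \<omega>)}"
    using pred_Omega_cond[OF X G.eps_vec T, of \<xi> x \<sigma>] by (intro prob_neg) (simp add: pred_def)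
  ultimately show ?thesis by simp
qed

text \<open>The limit is taken along an arbitrary filter, with dimensions, noise level, target
  vector and probability space all varying with the index; only \<open>x\<close> and
  \<open>\<xi>\<close> stay fixed.\<close>

theorem proposition4p1:
  fixes \<xi> x :: real
  assumes "0 < \<xi>" and "0 < x" and "x < 1"
  shows
    "(\<forall>n p k \<sigma> lam X \<beta> \<epsilon> y T \<beta>hat.
        0 < \<sigma> \<longrightarrow>
        X \<in> carrier_mat n p \<longrightarrow> \<beta> \<in> carrier_vec p \<longrightarrow> \<epsilon> \<in> carrier_vec n \<longrightarrow>
        y = X *\<^sub>v \<beta> + \<epsilon> \<longrightarrow>
        T = vec_support \<beta> \<longrightarrow> k = card T \<longrightarrow> 1 \<le> k \<longrightarrow>
        invertible_mat (gram X T) \<longrightarrow>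
        lam = lasso_lambda \<xi> \<sigma> p k \<longrightarrow>
        is_arg_min (lasso_objective X y lam) (\<lambda>b. b \<in> carrier_vec p) \<beta>hat \<longrightarrow>
        Omega_cond \<xi> x \<sigma> T X \<epsilon> \<longrightarrow>
        \<comment> \<open>in the extended reals, where a positive number divided by 0 is \<open>\<infinity>\<close>\<close>
        ereal (max (RE X T \<xi> * norm2 (\<beta>hat - \<beta>)) (norm2 (X *\<^sub>v (\<beta>hat - \<beta>)) / sqrt n))
          \<le> ereal (lam * (sqrt k + 1 / 10) + \<sigma> * sqrt k * (1 + x))
              / ereal (sqrt n * min 1 (RE X T \<xi>)))
     \<and>
     (\<forall>(F :: 'i filter) n p k \<sigma> \<beta> T (M :: 'i \<Rightarrow> 'a measure) X \<epsilon>.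
        (\<forall>i. 0 < \<sigma> i \<and>
             \<beta> i \<in> carrier_vec (p i) \<and>
             T i = vec_support (\<beta> i) \<and> k i = card (T i) \<and> 1 \<le> k i \<and>
             prob_space (M i) \<and>
             isotropic_gaussian (M i) (n i) (\<sigma> i) (\<epsilon> i) \<and>
             indep_rv (M i) (borel_mat (n i) (p i)) (X i) (borel_vec (n i)) (\<epsilon> i) \<and>
             (AE \<omega> in M i. invertible_mat (gram (X i \<omega>) (T i))) \<and>
             (AE \<omega> in M i. \<forall>j<p i. norm2 (X i \<omega> *\<^sub>v unit_vec (p i) j) \<le> sqrt (n i))) \<longrightarrow>
        filterlim (\<lambda>i. real (p i) / real (k i)) at_top F \<longrightarrow>
        ((\<lambda>i. measure (M i) {\<omega> \<in> space (M i). Omega_cond \<xi> x (\<sigma> i) (T i) (X i \<omega>) (\<epsilon> i \<omega>)})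
           \<longlongrightarrow> 1) F)"
proof (rule conjI; (intro allI impI)?)
  fix n p k \<sigma> lam X \<beta> \<epsilon> y T \<beta>hat
  assume "0 < \<sigma>" "X \<in> carrier_mat n p" "\<beta> \<in> carrier_vec p" "\<epsilon> \<in> carrier_vec n"
    "y = X *\<^sub>v \<beta> + \<epsilon>" "T = vec_support \<beta>" "k = card T" "1 \<le> k" "invertible_mat (gram X T)"
    "lam = lasso_lambda \<xi> \<sigma> p k"
    "is_arg_min (lasso_objective X y lam) (\<lambda>b. b \<in> carrier_vec p) \<beta>hat" "Omega_cond \<xi> x \<sigma> T X \<epsilon>"
  then show "ereal (max (RE X T \<xi> * norm2 (\<beta>hat - \<beta>)) (norm2 (X *\<^sub>v (\<beta>hat - \<beta>)) / sqrt n))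
      \<le> ereal (lam * (sqrt k + 1 / 10) + \<sigma> * sqrt k * (1 + x))
          / ereal (sqrt n * min 1 (RE X T \<xi>))"
    by (rule lasso_bound[OF assms])
next
  fix F :: "'i filter" and n p k \<sigma> \<beta> T and M :: "'i \<Rightarrow> 'a measure" and X \<epsilon>
  assume hyps: "\<forall>i. 0 < \<sigma> i \<and>
             \<beta> i \<in> carrier_vec (p i) \<and>
             T i = vec_support (\<beta> i) \<and> k i = card (T i) \<and> 1 \<le> k i \<and>
             prob_space (M i) \<and>
             isotropic_gaussian (M i) (n i) (\<sigma> i) (\<epsilon> i) \<and>
             indep_rv (M i) (borel_mat (n i) (p i)) (X i) (borel_vec (n i)) (\<epsilon> i) \<and>
             (AE \<omega> in M i. invertible_mat (gram (X i \<omega>) (T i))) \<and>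
             (AE \<omega> in M i. \<forall>j<p i. norm2 (X i \<omega> *\<^sub>v unit_vec (p i) j) \<le> sqrt (n i))"
    and lim: "filterlim (\<lambda>i. real (p i) / real (k i)) at_top F"
  define C where "C = 4 / x\<^sup>2 + 50"
  have lower: "1 - C / (2 * ln (exp 1 * (real (p i) / real (k i))))
      \<le> measure (M i) {\<omega> \<in> space (M i). Omega_cond \<xi> x (\<sigma> i) (T i) (X i \<omega>) (\<epsilon> i \<omega>)}" for i
  proof -
    have "\<beta> i \<in> carrier_vec (p i)" "T i = vec_support (\<beta> i)" using hyps by blast+
    then have "T i \<subseteq> {..<p i}" by (auto simp: vec_support_def)
    moreover have k: "k i = card (T i)" and "1 \<le> card (T i)" using hyps[rule_format, of i] by auto
    ultimately have "1 - C / (2 * ln (exp 1 * real (p i) / real (card (T i))))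
        \<le> measure (M i) {\<omega> \<in> space (M i). Omega_cond \<xi> x (\<sigma> i) (T i) (X i \<omega>) (\<epsilon> i \<omega>)}"
      unfolding C_def by (intro Omega_cond_prob[where p = "p i" and n = "n i"]) (use hyps assms in blast)+
    then show ?thesis by (simp add: k)
  qed
  have "filterlim (\<lambda>i. 2 * ln (exp 1 * (real (p i) / real (k i)))) at_top F"
    by (intro filterlim_tendsto_pos_mult_at_top[OF tendsto_const] filterlim_compose[OF ln_at_top] lim) auto
  then have "((\<lambda>i. C / (2 * ln (exp 1 * (real (p i) / real (k i))))) \<longlongrightarrow> 0) F"
    by (intro tendsto_divide_0[OF tendsto_const] filterlim_at_top_imp_at_infinity)
  from tendsto_diff[OF tendsto_const this, of 1]
  have "((\<lambda>i. 1 - C / (2 * ln (exp 1 * (real (p i) / real (k i))))) \<longlongrightarrow> 1) F" by simp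
  then show "((\<lambda>i. measure (M i) {\<omega> \<in> space (M i). Omega_cond \<xi> x (\<sigma> i) (T i) (X i \<omega>) (\<epsilon> i \<omega>)}) \<longlongrightarrow> 1) F"
    \<comment> \<open>Squeezed between the explicit lower bound, whose constant \<open>C\<close>
      depends on \<open>x\<close> alone, and 1.\<close>
    by (rule tendsto_sandwich[rotated 2, OF _ tendsto_const])
      (use lower hyps in \<open>auto intro!: always_eventually prob_space.prob_le_1\<close>)
qed

end
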